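(* Let $n \in \mathbb{N}$ ($n\ge1$), $a,b,c,d \in \mathbb{R}$, and let $\lambda_1,\dots,\lambda_{n+2}$, $\mathbf{H}_n$, and (according to the parity of $n$) $\mathbf{R}_n,\mathbf{P}_n$ and the polynomials $F,G$ be as defined in the context. (a) If $n$ is even, $\lambda_{1},\lambda_{3},\ldots,\lambda_{n+1}$ are all distinct and $\lambda_{2},\lambda_{4},\ldots,\lambda_{n+2}$ are all distinct, then $$\mathbf{H}_{n} = \mathbf{R}_{n} \mathbf{P}_{n}^{\top} \begin{bmatrix}\mathbf{F}_{n/2} & \mathbf{O} \\ \mathbf{O} & \mathbf{G}_{n/2}\end{bmatrix} \mathrm{diag} \left(\phi_{1}, \ldots, \phi_{n/2},\psi_{1},\ldots,\psi_{n/2} \right) \begin{bmatrix}\mathbf{F}_{n/2}^{-1} & \mathbf{O} \\ \mathbf{O} & \mathbf{G}_{n/2}^{-1}\end{bmatrix} \mathbf{P}_{n} \mathbf{R}_{n}^{-1},$$ where $\phi_{1},\ldots, \phi_{n/2}$ are the zeros of $F$, $\psi_{1},\ldots, \psi_{n/2}$ are the zeros of $G$, and $$\mathbf{F}_{n/2} = \left[\frac{(\lambda_{2k+1} - \lambda_{1}) \sin\left(\frac{(2k+1)\pi}{n + 3} \right)}{\lambda_{2k+1} - \phi_{\ell}} \right]_{1\le k,\ell\le n/2},\qquad \mathbf{G}_{n/2} = \left[\frac{(\lambda_{2k} - \lambda_{n+2}) \sin\left(\frac{2k\pi}{n + 3} \right)}{\lambda_{2k} - \psi_{\ell}}\right]_{1\le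 k,\ell\le n/2}.$$ (b) If $n$ is odd, $\lambda_{1},\lambda_{3},\ldots,\lambda_{n},\lambda_{n+2}$ are all distinct and $\lambda_{2},\lambda_{4},\ldots,\lambda_{n-1},\lambda_{n+1}$ are all distinct, then $$\mathbf{H}_{n} = \mathbf{R}_{n} \mathbf{P}_{n} \begin{bmatrix}\mathbf{F}_{(n+1)/2} & \mathbf{O} \\ \mathbf{O} & \mathbf{G}_{(n-1)/2}\end{bmatrix} \mathrm{diag} \left(\phi_{1}, \ldots, \phi_{(n+1)/2},\psi_{1},\ldots,\psi_{(n-1)/2} \right) \begin{bmatrix}\mathbf{F}_{(n+1)/2}^{-1} & \mathbf{O} \\ \mathbf{O} & \mathbf{G}_{(n-1)/2}^{-1}\end{bmatrix} \mathbf{P}_{n}^{\top} \mathbf{R}_{n}^{-1},$$ where $\phi_{1},\ldots, \phi_{(n+1)/2}$ are the zeros of $F$, $\psi_{1},\ldots, \psi_{(n-1)/2}$ are the zeros of $G$, and $$\mathbf{F}_{(n+1)/2} = \left[\frac{(\lambda_{2k+1} - \lambda_{1}) \sin\left(\frac{(2k+1)\pi}{n + 3} \right)}{\lambda_{2k+1} - \phi_{\ell}} \right]_{1\le k,\ell\le (n+1)/2},\qquad \mathbf{G}_{(n-1)/2} = \left[\frac{(\lambda_{2k} - \lambda_{n+1}) \sin\left(\frac{2k\pi}{n + 3} \right)}{\lambda_{2k} - \psi_{\ell}} \right]_{1\le k,\ell\le (n-1)/2}.$$ (The existence of all the inverses and the nonvanishing of all denominators appearing above is implicit in the conclusion.)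
   Context: For $n\in\mathbb{N}$ and scalars $a,b,c,d$, $\mathbf{H}_n$ is the $n\times n$ anti-heptadiagonal persymmetric Hankel matrix with entries $[\mathbf{H}_n]_{k,\ell}=d$ if $k+\ell=n+1$; $=c$ if $|k+\ell-n-1|=1$; $=b$ if $|k+\ell-n-1|=2$; $=a$ if $|k+\ell-n-1|=3$; and $=0$ otherwise. For $k=1,2,\ldots,n+2$, $$\lambda_{k} = -2a \cos \left(\tfrac{n k \pi}{n+3} \right) - 2b \cos \left(\tfrac{(n + 1) k \pi}{n+3} \right) - 2c \cos \left(\tfrac{(n + 2) k \pi}{n+3} \right) - d \cos (k \pi).$$ Case $n$ even. $\mathbf{R}_n$ is the $n\times n$ matrix $[\mathbf{R}_n]_{k,\ell}=\sqrt{\frac{2}{n+3}}\sin\left(\frac{(k+1)(\ell+1)\pi}{n+3}\right)$. $\mathbf{P}_n$ is the $n\times n$ permutation matrix with $[\mathbf{P}_n]_{k,\ell}=1$ if $\ell=2k$ or $\ell=2k-n-1$, and $0$ otherwise. The polynomials are $$F(t) = \prod_{j=1}^{n/2}(t - \lambda_{2j+1}) + \frac{4}{n + 3} \sum_{j=1}^{n/2} \sin^{2} \left(\frac{(2j + 1) \pi}{n + 3} \right) (\lambda_{2j+1} - \lambda_{1}) \prod_{\substack{m=1 \\ m \neq j}}^{n/2}(t - \lambda_{2m+1}),$$ $$G(t) = \prod_{j=1}^{n/2}(t - \lambda_{2j}) + \frac{4}{n + 3} \sum_{j=1}^{n/2} \sin^{2} \left(\frac{2j \pi}{n + 3} \right)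 (\lambda_{2j} - \lambda_{n+2}) \prod_{\substack{m=1 \\ m \neq j}}^{n/2}(t - \lambda_{2m}).$$ Case $n$ odd. $\mathbf{R}_n$ is the $n\times n$ matrix with $[\mathbf{R}_n]_{k,\ell}=\sqrt{\frac{2}{n+3}}\sin\left(\frac{(k+1)(\ell+1)\pi}{n+3}\right)$ if $\ell<n$ and $[\mathbf{R}_n]_{k,n}=\sqrt{\frac{2}{n+3}}\sin\left(\frac{(k+1)(n+2)\pi}{n+3}\right)$. $\mathbf{P}_n$ is the $n\times n$ permutation matrix with $[\mathbf{P}_n]_{k,\ell}=1$ if $k=2\ell$, or $k=2\ell-n-2$, or ($k=n$ and $\ell=\frac{n+1}2$), and $0$ otherwise. The polynomials are $$F(t) = \prod_{j=1}^{(n+1)/2}(t - \lambda_{2j+1}) + \frac{4}{n + 3} \sum_{j=1}^{(n+1)/2} \sin^{2} \left(\frac{(2j + 1) \pi}{n + 3} \right) (\lambda_{2j+1} - \lambda_{1}) \prod_{\substack{m=1 \\ m \neq j}}^{(n+1)/2}(t - \lambda_{2m+1}),$$ $$G(t) = \prod_{j=1}^{(n-1)/2}(t - \lambda_{2j}) + \frac{4}{n + 3} \sum_{j=1}^{(n-1)/2} \sin^{2} \left(\frac{2j \pi}{n + 3} \right) (\lambda_{2j} - \lambda_{n+1}) \prod_{\substack{m=1 \\ m \neq j}}^{(n-1)/2}(t - \lambda_{2m}).$$ Zeros are listed with multiplicity. $\mathbf{O}$ denotes zero blocks; for $n=1$ blocks of size $(n-1)/2=0$ are absent. *)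

theory Defs
  imports
    Complex_Main
    "HOL-Computational_Algebra.Fundamental_Theorem_Algebra"
    "Jordan_Normal_Form.Gauss_Jordan_Elimination"
begin

text \<open>The matrix entries below are given by formulas in row and column indices that start at 1,
  whereas the indices of the type of matrices start at 0.\<close>

definition mat1 :: "nat \<Rightarrow> nat \<Rightarrow> (nat \<Rightarrow> nat \<Rightarrow> 'a) \<Rightarrow> 'a mat" where
  "mat1 nr nc f = mat nr nc (\<lambda>(i, j). f (Suc i) (Suc j))"

abbreviation cmat :: "real mat \<Rightarrow> complex mat" where
  "cmat A \<equiv> map_mat complex_of_real A"

abbreviation cpoly :: "real poly \<Rightarrow> complex poly" where
  "cpoly p \<equiv> map_poly complex_of_real p"

text \<open>Only meaningful for invertible matrices; invertibility has to be stated separately.\<close>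

abbreviation minv :: "'a :: field mat \<Rightarrow> 'a mat" where
  "minv A \<equiv> the (mat_inverse A)"

definition hankel_mat :: "nat \<Rightarrow> real \<Rightarrow> real \<Rightarrow> real \<Rightarrow> real \<Rightarrow> real mat" where
  "hankel_mat n a b c d = mat1 n n (\<lambda>k l.
     let s = \<bar>int k + int l - int n - 1\<bar> in
     if s = 0 then d else if s = 1 then c else if s = 2 then b else if s = 3 then a else 0)"

definition lam :: "nat \<Rightarrow> real \<Rightarrow> real \<Rightarrow> real \<Rightarrow> real \<Rightarrow> nat \<Rightarrow> real" where
  "lam n a b c d k =
     - 2 * a * cos (real n * real k * pi / (real n + 3))
     - 2 * b * cos ((real n + 1) * real k * pi / (real n + 3))
     - 2 * c * cos ((real n + 2) * real k * pi / (real n + 3))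
     - d * cos (real k * pi)"

definition R_even :: "nat \<Rightarrow> real mat" where
  "R_even n = mat1 n n (\<lambda>k l.
     sqrt (2 / (real n + 3)) * sin ((real k + 1) * (real l + 1) * pi / (real n + 3)))"

definition R_odd :: "nat \<Rightarrow> real mat" where
  "R_odd n = mat1 n n (\<lambda>k l.
     if l < n
     then sqrt (2 / (real n + 3)) * sin ((real k + 1) * (real l + 1) * pi / (real n + 3))
     else sqrt (2 / (real n + 3)) * sin ((real k + 1) * (real n + 2) * pi / (real n + 3)))"

text \<open>Equations with a subtraction between indices are stated in additive form, since subtraction
  of natural numbers truncates.\<close>

definition P_even :: "nat \<Rightarrow> real mat" where
  "P_even n = mat1 n n (\<lambda>k l. if l = 2 * k \<or> l + n + 1 = 2 * k then 1 else 0)"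

definition P_odd :: "nat \<Rightarrow> real mat" where
  "P_odd n = mat1 n n (\<lambda>k l.
     if k = 2 * l \<or> k + n + 2 = 2 * l \<or> (k = n \<and> l = (n + 1) div 2) then 1 else 0)"

text \<open>In the next four definitions, \<open>m\<close> is the size of the block. In the two that concern the
  even-indexed values, \<open>r\<close> is the largest even index, which is \<open>n + 2\<close> for even \<open>n\<close> and
  \<open>n + 1\<close> for odd \<open>n\<close>.\<close>

definition F_poly :: "nat \<Rightarrow> real \<Rightarrow> real \<Rightarrow> real \<Rightarrow> real \<Rightarrow> nat \<Rightarrow> real poly" where
  "F_poly n a b c d m =
     (\<Prod>j = 1..m. [:- lam n a b c d (2 * j + 1), 1:])
     + Polynomial.smult (4 / (real n + 3))
         (\<Sum>j = 1..m. Polynomial.smult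
            ((sin (real (2 * j + 1) * pi / (real n + 3)))\<^sup>2
               * (lam n a b c d (2 * j + 1) - lam n a b c d 1))
            (\<Prod>i \<in> {1..m} - {j}. [:- lam n a b c d (2 * i + 1), 1:]))"

definition G_poly :: "nat \<Rightarrow> real \<Rightarrow> real \<Rightarrow> real \<Rightarrow> real \<Rightarrow> nat \<Rightarrow> nat \<Rightarrow> real poly" where
  "G_poly n a b c d r m =
     (\<Prod>j = 1..m. [:- lam n a b c d (2 * j), 1:])
     + Polynomial.smult (4 / (real n + 3))
         (\<Sum>j = 1..m. Polynomial.smult
            ((sin (real (2 * j) * pi / (real n + 3)))\<^sup>2
               * (lam n a b c d (2 * j) - lam n a b c d r))
            (\<Prod>i \<in> {1..m} - {j}. [:- lam n a b c d (2 * i), 1:]))"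

definition F_mat ::
  "nat \<Rightarrow> real \<Rightarrow> real \<Rightarrow> real \<Rightarrow> real \<Rightarrow> nat \<Rightarrow> (nat \<Rightarrow> complex) \<Rightarrow> complex mat" where
  "F_mat n a b c d m \<phi> = mat1 m m (\<lambda>k l.
     complex_of_real ((lam n a b c d (2 * k + 1) - lam n a b c d 1)
         * sin (real (2 * k + 1) * pi / (real n + 3)))
     / (complex_of_real (lam n a b c d (2 * k + 1)) - \<phi> l))"

definition G_mat ::
  "nat \<Rightarrow> real \<Rightarrow> real \<Rightarrow> real \<Rightarrow> real \<Rightarrow> nat \<Rightarrow> nat \<Rightarrow> (nat \<Rightarrow> complex) \<Rightarrow> complex mat" where
  "G_mat n a b c d r m \<psi> = mat1 m m (\<lambda>k l.
     complex_of_real ((lam n a b c d (2 * k) - lam n a b c d r)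
         * sin (real (2 * k) * pi / (real n + 3)))
     / (complex_of_real (lam n a b c d (2 * k)) - \<psi> l))"

text \<open>The sequence \<open>\<phi> 1, \<dots>, \<phi> m\<close> lists all complex zeros of \<open>p\<close> with multiplicity, in any order.\<close>

definition lists_zeros :: "real poly \<Rightarrow> nat \<Rightarrow> (nat \<Rightarrow> complex) \<Rightarrow> bool" where
  "lists_zeros p m \<phi> \<longleftrightarrow> image_mset \<phi> (mset_set {1..m}) = proots (cpoly p)"

definition block_diag :: "'a :: zero mat \<Rightarrow> 'a mat \<Rightarrow> 'a mat" where
  "block_diag A B =
     four_block_mat A (0\<^sub>m (dim_row A) (dim_col B)) (0\<^sub>m (dim_row B) (dim_col A)) B"

text \<open>The matrix \<open>diag (\<phi> 1, \<dots>, \<phi> p, \<psi> 1, \<dots>, \<psi> q)\<close>.\<close>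

definition diag_zeros :: "nat \<Rightarrow> nat \<Rightarrow> (nat \<Rightarrow> complex) \<Rightarrow> (nat \<Rightarrow> complex) \<Rightarrow> complex mat" where
  "diag_zeros p q \<phi> \<psi> = mat_diag (p + q) (\<lambda>i. if i < p then \<phi> (Suc i) else \<psi> (Suc (i - p)))"

end

theory Submission
  imports Defs "Jordan_Normal_Form.Char_Poly"
begin

text \<open>Let \<open>S\<close> be the discrete sine transform of order \<open>n + 2\<close>. Deleting the first and the last row and
  column of \<open>S diag(\<lambda>\<^sub>1, \<dots>, \<lambda>\<^sub>n\<^sub>+\<^sub>2) S\<close> removes all boundary corrections and leaves \<open>H\<^sub>n\<close>, so
  \<open>H\<^sub>n = V diag(\<lambda>) V\<^sup>T\<close> where \<open>V\<close> consists of the inner rows of \<open>S\<close>. Orthogonality of the inner rows to the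
  first and last row gives two linear relations between the columns of \<open>V\<close>, one between the odd and
  one between the even columns. Eliminating column 1 and the last even column by means of them turns
  \<open>H\<^sub>n\<close> into a block diagonal matrix with two blocks, each a diagonal matrix minus a matrix of rank
  one. The eigenvectors of such a block have the entries of \<open>F\<close> and \<open>G\<close>, and its eigenvalues are the
  zeros of the secular polynomial.\<close>

subsection \<open>The sine transform of the Hankel matrix\<close>

text \<open>Each summand times \<open>2 * sin (x / 2)\<close> is a difference of sines at
  consecutive half-integer multiples of \<open>x\<close>, so the sum collapses. The factor stays on
  the left because it may vanish.\<close>

lemma sum_cos_telescope:
  fixes x :: real
  shows "2 * sin (x / 2) * (\<Sum>m = 1..N. cos (real m * x)) = sin ((real N + 1 / 2) * x) - sin (x / 2)"
proof (induction N)
  case (Suc N)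
  have "2 * sin (x / 2) * cos (real (Suc N) * x) = sin ((real (Suc N) + 1 / 2) * x) - sin ((real N + 1 / 2) * x)"
    proof -
    have "((real (Suc N) + 1 / 2) * x - (real N + 1 / 2) * x) / 2 = x / 2"
      and "((real (Suc N) + 1 / 2) * x + (real N + 1 / 2) * x) / 2 = real (Suc N) * x"
      by (simp_all add: algebra_simps)
    then show ?thesis by (simp only: sin_diff_sin)
  qed
  with Suc show ?case by (simp add: distrib_left)
qed simp

lemma cos_int_pi: "cos (of_int k * pi) = (if even k then 1 else - 1 :: real)"
  using cos_npi_int[of k] by (simp add: mult.commute)

text \<open>If \<open>2 * L\<close> divides \<open>k\<close>, all \<open>L - 1\<close> cosines equal
  1. Otherwise the telescoped sum is -1 for even \<open>k\<close> and 0 for odd \<open>k\<close>.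
  Writing both cases as one difference isolates a parity term that cancels later.\<close>

lemma sum_cos_roots:
  fixes k :: int
  assumes "L > 0"
  shows "(\<Sum>m \<in> {1..<L}. cos (of_int k * real m * pi / real L))
    = (if 2 * int L dvd k then real L else 0) - (if even k then 1 else 0)"
proof -
  define x where "x = of_int k * pi / real L"
  have L: "{1..<L} = {1..L - 1}" using assms by auto
  have S: "(\<Sum>m \<in> {1..<L}. cos (of_int k * real m * pi / real L)) = (\<Sum>m = 1..L - 1. cos (real m * x))"
    unfolding L by (simp add: x_def mult_ac)
  show ?thesis
  proof (cases "2 * int L dvd k")
    case True
    then obtain j where j: "k = 2 * int L * j" by (elim dvdE)
    have "cos (real m * x) = 1" for m
    proof -
      have "real m * x = 2 * pi * of_int (int m * j)" using assms by (simp add: x_def j)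
      then show ?thesis by (simp only: cos_int_2pin)
    qed
    then show ?thesis using S assms True j by (simp add: of_nat_diff)
  next
    case False
    have nz: "sin (x / 2) \<noteq> 0"
    proof
      assume "sin (x / 2) = 0"
      then obtain i :: int where "x / 2 = of_int i * pi" using sin_zero_iff_int2 by blast
      then have "of_int k * pi = (of_int (2 * int L * i)) * pi" using assms by (simp add: x_def field_simps)
      then have "k = 2 * int L * i" by (metis mult_right_cancel of_int_eq_iff pi_neq_zero)
      with False show False by simp
    qed
    \<comment> \<open>The upper limit \<open>L - 1\<close> puts the last half-integer multiple at
      distance \<open>x / 2\<close> from \<open>k * pi\<close>, so that \<open>sin (x / 2)\<close>
      can be cancelled.\<close>
    have "(real (L - 1) + 1 / 2) * x = of_int k * pi - x / 2"
      using assms by (simp add: x_def of_nat_diff field_simps)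
    then have "sin ((real (L - 1) + 1 / 2) * x) = - cos (of_int k * pi) * sin (x / 2)"
      using sin_npi_int[of k] by (simp add: sin_diff mult.commute)
    with sum_cos_telescope[of x "L - 1"]
    have "2 * sin (x / 2) * (\<Sum>m = 1..L - 1. cos (real m * x)) = 2 * sin (x / 2) * (- (cos (of_int k * pi) + 1) / 2)"
      by (simp add: algebra_simps)
    then have "(\<Sum>m = 1..L - 1. cos (real m * x)) = - (cos (of_int k * pi) + 1) / 2"
      using nz by (simp only: mult_cancel_left) simp
    then show ?thesis unfolding S cos_int_pi using False by (cases "even k") simp_all
  qed
qed

text \<open>Product-to-sum formulas turn each summand into four cosines with frequencies
  \<open>x\<close> \<plusminus> \<open>i\<close> \<plusminus> \<open>j\<close>, to which
  \<open>sum_cos_roots\<close> applies.\<close>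

lemma sum_cos_sin_sin:
  fixes x i j :: int
  assumes "L > 0"
  defines "\<delta> \<equiv> \<lambda>k. if 2 * int L dvd k then 1 else 0 :: real"
  shows "(\<Sum>m \<in> {1..<L}. 2 * cos (of_int x * real m * pi / real L)
      * (sin (of_int i * real m * pi / real L) * sin (of_int j * real m * pi / real L)))
    = real L / 2 * (\<delta> (x + i - j) + \<delta> (x - i + j) - \<delta> (x + i + j) - \<delta> (x - i - j))"
proof -
  define C where "C k = (\<Sum>m \<in> {1..<L}. cos (of_int k * real m * pi / real L))" for k :: int
  have "(\<Sum>m \<in> {1..<L}. 2 * cos (of_int x * real m * pi / real L)
      * (sin (of_int i * real m * pi / real L) * sin (of_int j * real m * pi / real L)))
    = (\<Sum>m \<in> {1..<L}. (cos (of_int (x + i - j) * real m * pi / real L)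
      + cos (of_int (x - i + j) * real m * pi / real L) - cos (of_int (x + i + j) * real m * pi / real L)
      - cos (of_int (x - i - j) * real m * pi / real L)) / 2)"
  proof (rule sum.cong[OF refl])
    fix m
    define t where "t = real m * pi / real L"
    have *: "of_int k * real m * pi / real L = of_int k * t" for k by (simp add: t_def)
    show "2 * cos (of_int x * real m * pi / real L)
      * (sin (of_int i * real m * pi / real L) * sin (of_int j * real m * pi / real L))
      = (cos (of_int (x + i - j) * real m * pi / real L)
      + cos (of_int (x - i + j) * real m * pi / real L) - cos (of_int (x + i + j) * real m * pi / real L)
      - cos (of_int (x - i - j) * real m * pi / real L)) / 2"
      unfolding * by (simp add: distrib_right left_diff_distrib cos_add cos_diff sin_add sin_diff algebra_simps)
  qed
  also have "\<dots> = (C (x + i - j) + C (x - i + j) - C (x + i + j) - C (x - i - j)) / 2"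
    unfolding C_def by (simp only: sum_divide_distrib[symmetric] sum.distrib sum_subtractf)
  also have "\<dots> = real L / 2 * (\<delta> (x + i - j) + \<delta> (x - i + j) - \<delta> (x + i + j) - \<delta> (x - i - j))"
  proof -
    define e where "e k = (if even k then 1 else 0 :: real)" for k :: int
    \<comment> \<open>The four frequencies have the same parity and each sign occurs twice, so the
      parity terms cancel.\<close>
    have e: "e (x - i + j) = e (x + i - j)" "e (x + i + j) = e (x + i - j)" "e (x - i - j) = e (x + i - j)"
      by (simp_all add: e_def)
    have C: "C k = real L * \<delta> k - e k" for k
      unfolding C_def sum_cos_roots[OF assms(1)] \<delta>_def e_def by simp
    show ?thesis unfolding C e by (simp add: right_diff_distrib distrib_left diff_divide_distrib add_divide_distrib)
  qed
  finally show ?thesis .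
qed

text \<open>The discrete sine transform of order \<open>n + 2\<close>; indices start at 1.\<close>

definition dst :: "nat \<Rightarrow> nat \<Rightarrow> nat \<Rightarrow> real" where
  "dst n i m = sqrt (2 / (real n + 3)) * sin (real i * real m * pi / (real n + 3))"

lemma dst_commute: "dst n i m = dst n m i"
  by (simp add: dst_def mult.commute[of "real i"])

lemma dst_mult:
  "dst n i m * dst n j k = 2 / (real n + 3) *
    (sin (real i * real m * pi / (real n + 3)) * sin (real j * real k * pi / (real n + 3)))"
proof -
  have "(u * v) * (u * w) = (u * u) * (v * w)" for u v w :: real by (simp only: mult_ac)
  then show ?thesis unfolding dst_def by (simp only: ) simp
qed

lemma not_dvd_between: "0 < z \<Longrightarrow> z < d \<Longrightarrow> \<not> d dvd z" for z d :: int
  by (simp add: zdvd_not_zless)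

lemma dvd_abs_less: "\<bar>z\<bar> < d \<Longrightarrow> d dvd z \<longleftrightarrow> z = 0" for z d :: int
  using dvd_imp_le_int[of z d] by auto

text \<open>This is the case \<open>x = 0\<close> of \<open>sum_cos_sin_sin\<close>:
  \<open>i + j\<close> lies strictly between 0 and the period \<open>2 * (n + 3)\<close>, so only
  \<open>i - j = 0\<close> contributes.\<close>

lemma sum_dst_mult:
  assumes "i \<in> {1..n + 2}" "j \<in> {1..n + 2}"
  shows "(\<Sum>m = 1..n + 2. dst n i m * dst n j m) = (if i = j then 1 else 0)"
proof -
  have S: "{1..n + 2} = {1..<n + 3}" by auto
  have "(\<Sum>m = 1..n + 2. dst n i m * dst n j m) = 1 / (real n + 3) *
    (\<Sum>m \<in> {1..<n + 3}. 2 * cos (of_int 0 * real m * pi / real (n + 3)) *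
      (sin (of_int (int i) * real m * pi / real (n + 3)) * sin (of_int (int j) * real m * pi / real (n + 3))))"
    unfolding S sum_distrib_left dst_mult by (intro sum.cong) (auto simp: add.commute)
  also have "\<dots> = (if i = j then 1 else 0)"
  proof -
    have "2 * int (n + 3) dvd 0 + int i - int j \<longleftrightarrow> i = j" using assms by (subst dvd_abs_less) auto
    moreover have "2 * int (n + 3) dvd 0 - int i + int j \<longleftrightarrow> i = j" using assms by (subst dvd_abs_less) auto
    moreover have "\<not> 2 * int (n + 3) dvd 0 + int i + int j" using assms by (intro not_dvd_between) auto
    moreover have "\<not> 2 * int (n + 3) dvd 0 - int i - int j" using assms by (subst dvd_abs_less) auto
    ultimately show ?thesis by (subst sum_cos_sin_sin) simp_all
  qed
  finally show ?thesis .
qed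

text \<open>For inner rows and \<open>h \<le> 3\<close>, both \<open>x + i - j\<close> and
  \<open>x - i + j\<close> lie strictly between 0 and \<open>2 * (n + 3)\<close>. Only
  \<open>x - i - j = 0\<close> and \<open>x + i + j = 2 * (n + 3)\<close> survive, which are the two
  antidiagonals at distance \<open>h\<close> from the main one.\<close>

lemma sum_cos_dst_mult:
  assumes "i \<in> {2..n + 1}" "j \<in> {2..n + 1}" "h \<le> 3"
  shows "(\<Sum>m = 1..n + 2. - 2 * cos ((real n + 3 - real h) * real m * pi / (real n + 3)) * (dst n i m * dst n j m))
    = (if i + j + h = n + 3 then 1 else 0) + (if i + j = n + 3 + h then 1 else 0)"
proof -
  define x where "x = int n + 3 - int h"
  have S: "{1..n + 2} = {1..<n + 3}" by auto
  have "(\<Sum>m = 1..n + 2. - 2 * cos ((real n + 3 - real h) * real m * pi / (real n + 3)) * (dst n i m * dst n j m))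
    = - 2 / (real n + 3) *
    (\<Sum>m \<in> {1..<n + 3}. 2 * cos (of_int x * real m * pi / real (n + 3)) *
      (sin (of_int (int i) * real m * pi / real (n + 3)) * sin (of_int (int j) * real m * pi / real (n + 3))))"
    unfolding S sum_distrib_left dst_mult by (intro sum.cong) (auto simp: add.commute x_def)
  also have "\<dots> = (if i + j + h = n + 3 then 1 else 0) + (if i + j = n + 3 + h then 1 else 0)"
  proof -
    have "\<not> 2 * int (n + 3) dvd x + int i - int j" using assms by (intro not_dvd_between) (auto simp: x_def)
    moreover have "\<not> 2 * int (n + 3) dvd x - int i + int j" using assms by (intro not_dvd_between) (auto simp: x_def)
    moreover have "2 * int (n + 3) dvd x - int i - int j \<longleftrightarrow> i + j + h = n + 3"
      using assms by (subst dvd_abs_less) (auto simp: x_def)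
    moreover have "2 * int (n + 3) dvd x + int i + int j \<longleftrightarrow> i + j = n + 3 + h"
    proof -
      \<comment> \<open>Subtracting one period brings the number into the range where only 0 is
        divisible.\<close>
      have "2 * int (n + 3) dvd x + int i + int j \<longleftrightarrow> 2 * int (n + 3) dvd (x + int i + int j) - 2 * int (n + 3)"
        by (simp only: dvd_diff_left_iff[OF dvd_refl])
      also have "\<dots> \<longleftrightarrow> i + j = n + 3 + h" using assms by (subst dvd_abs_less) (auto simp: x_def)
      finally show ?thesis .
    qed
    ultimately show ?thesis by (subst sum_cos_sin_sin) simp_all
  qed
  finally show ?thesis .
qed

text \<open>\<open>lam\<close> combines the cosine factors of \<open>sum_cos_dst_mult\<close> for
  \<open>h\<close> = 3, 2, 1, 0. The shift by 2 converts zero-based matrix indices and skips row 1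
  of the sine transform.\<close>

lemma sum_lam_dst_mult:
  assumes "i < n" "j < n"
  shows "(\<Sum>m = 1..n + 2. lam n a b c d m * (dst n (i + 2) m * dst n (j + 2) m))
    = hankel_mat n a b c d $$ (i, j)"
proof -
  define K where "K h = (\<Sum>m = 1..n + 2. - 2 * cos ((real n + 3 - real h) * real m * pi / (real n + 3))
      * (dst n (i + 2) m * dst n (j + 2) m))" for h
  \<comment> \<open>For \<open>h = 0\<close> both indicators of \<open>sum_cos_dst_mult\<close> hold
    on the same antidiagonal, hence the coefficient \<open>d / 2\<close>.\<close>
  have "lam n a b c d m = a * (- 2 * cos ((real n + 3 - real 3) * real m * pi / (real n + 3)))
    + b * (- 2 * cos ((real n + 3 - real 2) * real m * pi / (real n + 3)))
    + c * (- 2 * cos ((real n + 3 - real 1) * real m * pi / (real n + 3)))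
    + d / 2 * (- 2 * cos ((real n + 3 - real 0) * real m * pi / (real n + 3)))" for m
    by (simp add: lam_def add.commute)
  then have "(\<Sum>m = 1..n + 2. lam n a b c d m * (dst n (i + 2) m * dst n (j + 2) m))
    = a * K 3 + b * K 2 + c * K 1 + d / 2 * K 0"
    unfolding K_def by (simp only: distrib_right sum.distrib mult.assoc sum_distrib_left)
  also have "\<dots> = hankel_mat n a b c d $$ (i, j)"
    using assms unfolding K_def
    by (subst (1 2 3 4) sum_cos_dst_mult) (auto simp: hankel_mat_def mat1_def Let_def split: if_splits)
  finally show ?thesis .
qed

subsection \<open>Matrices\<close>

lemma mat1_mult:
  fixes f g :: "nat \<Rightarrow> nat \<Rightarrow> 'a :: semiring_0"
  shows "mat1 n m f * mat1 m p g = mat1 n p (\<lambda>i j. \<Sum>k = 1..m. f i k * g k j)"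
  by (rule eq_matI) (auto simp: mat1_def scalar_prod_def sum.atLeast1_atMost_eq atLeast0LessThan)

lemma mat1_carrier [simp]: "mat1 n m f \<in> carrier_mat n m"
  by (simp add: mat1_def)

lemma mat1_eqI:
  assumes "\<And>i j. i \<in> {1..n} \<Longrightarrow> j \<in> {1..m} \<Longrightarrow> f i j = g i j"
  shows "mat1 n m f = mat1 n m g"
  using assms by (auto simp: mat1_def intro!: eq_matI)

lemma mat_diag_mat1: "mat_diag n f = mat1 n n (\<lambda>i j. if i = j then f (i - 1) else 0)"
  by (rule eq_matI) (auto simp: mat_diag_def mat1_def)

lemma one_mat1: "1\<^sub>m n = mat1 n n (\<lambda>i j. if i = j then 1 else 0)"
  by (rule eq_matI) (auto simp: mat1_def)

lemma transpose_mat1: "transpose_mat (mat1 n m f) = mat1 m n (\<lambda>i j. f j i)"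
  by (rule eq_matI) (auto simp: mat1_def)

text \<open>Invertibility makes \<open>A\<close> a unit of the matrix ring, which rules out
  \<open>None\<close> as the value of \<open>mat_inverse\<close>; so \<open>the\<close> returns a
  genuine inverse.\<close>

lemma minv_inverse:
  fixes A :: "'a :: field mat"
  assumes A: "A \<in> carrier_mat n n" and inv: "invertible_mat A"
  shows "A * minv A = 1\<^sub>m n" "minv A \<in> carrier_mat n n"
proof -
  obtain B where B: "A * B = 1\<^sub>m n" "B * A = 1\<^sub>m (dim_row B)"
    using inv A by (auto simp: invertible_mat_def inverts_mat_def)
  then have "B \<in> carrier_mat n n"
    using A by (metis carrier_matD(2) carrier_matI index_mult_mat(3) index_one_mat(3))
  then have "A \<in> Units (ring_mat TYPE('a) n ())"
    using A B by (auto simp: Units_def ring_mat_simps)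
  then obtain C where "mat_inverse A = Some C"
    using mat_inverse(1)[OF A, of "()"] by (cases "mat_inverse A") auto
  with mat_inverse(2)[OF A this] show "A * minv A = 1\<^sub>m n" "minv A \<in> carrier_mat n n" by auto
qed

lemma invertible_matI_right:
  fixes A :: "'a :: field mat"
  assumes "A \<in> carrier_mat n n" "B \<in> carrier_mat n n" "A * B = 1\<^sub>m n"
  shows "invertible_mat A"
  using assms mat_mult_left_right_inverse[OF assms] by (auto simp: invertible_mat_def inverts_mat_def)

text \<open>\<open>R * Q\<close> transforms \<open>H\<close> into \<open>M\<close>, and
  \<open>B\<close> diagonalizes \<open>M\<close>. The inverse of \<open>Q\<close> is given on the
  left because it will be a transpose; for square matrices it is also a right inverse.\<close>

lemma diagonalization_transfer:
  fixes H :: "'a :: field mat"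
  assumes carrier: "H \<in> carrier_mat n n" "R \<in> carrier_mat n n" "Q \<in> carrier_mat n n" "M \<in> carrier_mat n n"
      "B \<in> carrier_mat n n" "D \<in> carrier_mat n n" "C \<in> carrier_mat n n" "T \<in> carrier_mat n n" "S \<in> carrier_mat n n"
    and HRQ: "H * (R * Q) = R * Q * M" and MB: "M * B = B * D"
    and inverses: "B * C = 1\<^sub>m n" "T * Q = 1\<^sub>m n" "R * S = 1\<^sub>m n"
  shows "H = R * Q * B * D * C * T * S"
proof -
  note assoc = assoc_mult_mat[of _ n n _ n _ n]
  have QT: "Q * T = 1\<^sub>m n" using mat_mult_left_right_inverse carrier inverses by blast
  have "R * Q * (T * S) = R * ((Q * T) * S)"
    using carrier by (simp add: assoc)
  then have RQTS: "R * Q * (T * S) = 1\<^sub>m n"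
    using carrier inverses by (simp add: QT)
  have "M * (B * C) = M * B * C" by (rule assoc[symmetric]) (use carrier in auto)
  then have M: "M = B * D * C"
    using carrier inverses(1) by (simp add: MB)
  have "H = H * (R * Q * (T * S))" using carrier by (simp add: RQTS)
  also have "\<dots> = H * (R * Q) * (T * S)"
    by (rule assoc[symmetric]) (use carrier in auto)
  also have "\<dots> = R * Q * (B * D * C) * (T * S)"
    by (simp only: HRQ M)
  finally show ?thesis using carrier by (simp add: assoc)
qed

section \<open>Algebra of block diagonal matrices\<close>

lemma block_diag_mult:
  assumes "A \<in> carrier_mat p p" "B \<in> carrier_mat q q" "C \<in> carrier_mat p p" "D \<in> carrier_mat q q"
  shows "block_diag A B * block_diag C D = block_diag (A * C) (B * D)"
  using assms unfolding block_diag_def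
  by (subst mult_four_block_mat[of _ p p _ q _ q _ _ p _ q]) auto

lemma block_diag_carrier:
  "A \<in> carrier_mat p p \<Longrightarrow> B \<in> carrier_mat q q \<Longrightarrow> block_diag A B \<in> carrier_mat (p + q) (p + q)"
  by (auto simp: block_diag_def)

lemma block_diag_mat1:
  "block_diag (mat1 p p f) (mat1 q q g) = mat1 (p + q) (p + q) (\<lambda>k l.
    if k \<le> p then if l \<le> p then f k l else 0 else if l \<le> p then 0 else g (k - p) (l - p))"
  by (rule eq_matI) (auto simp: block_diag_def mat1_def Suc_diff_le)

lemma diag_zeros_block_diag:
  "diag_zeros p q \<phi> \<psi> = block_diag (mat_diag p (\<lambda>i. \<phi> (Suc i))) (mat_diag q (\<lambda>i. \<psi> (Suc i)))"
  by (rule eq_matI) (auto simp: diag_zeros_def block_diag_def mat_diag_def)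

lemma cmat_block_diag:
  assumes "A \<in> carrier_mat p p" "B \<in> carrier_mat q q"
  shows "cmat (block_diag A B) = block_diag (cmat A) (cmat B)"
  using assms unfolding block_diag_def by (intro eq_matI) auto

lemma sum_atLeast1_add:
  "(\<Sum>k = 1..p + q. f k) = (\<Sum>k = 1..p. f k) + (\<Sum>k = 1..q. f (p + k))" for f :: "nat \<Rightarrow> 'a :: comm_monoid_add"
proof -
  have "(\<Sum>k = 1..q. f (p + k)) = (\<Sum>k = p + 1..p + q. f k)"
    using sum.shift_bounds_cl_nat_ivl[of f 1 p q] by (simp add: add.commute)
  then show ?thesis using sum.ub_add_nat[of 1 p f q] by simp
qed

section \<open>Matrices that select columns\<close>

text \<open>Column \<open>l\<close> of the second factor is the unit vector at position
  \<open>\<sigma> l\<close>.\<close>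

lemma mat1_mult_selection:
  fixes f :: "nat \<Rightarrow> nat \<Rightarrow> real"
  assumes "\<And>j. j \<in> {1..n} \<Longrightarrow> \<sigma> j \<in> {1..n}"
  shows "mat1 n n f * mat1 n n (\<lambda>k l. if k = \<sigma> l then 1 else 0) = mat1 n n (\<lambda>i j. f i (\<sigma> j))"
  unfolding mat1_mult
proof (rule mat1_eqI)
  fix i j assume "j \<in> {1..n}"
  with assms show "(\<Sum>k = 1..n. f i k * (if k = \<sigma> j then 1 else 0)) = f i (\<sigma> j)"
    by (simp add: if_distrib[of "(*) _"] cong: if_cong)
qed

lemma transpose_selection_mult:
  assumes "\<And>j. j \<in> {1..n} \<Longrightarrow> \<sigma> j \<in> {1..n}" "inj_on \<sigma> {1..n}"
  shows "transpose_mat (mat1 n n (\<lambda>k l. if k = \<sigma> l then 1 else 0 :: real))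
    * mat1 n n (\<lambda>k l. if k = \<sigma> l then 1 else 0) = 1\<^sub>m n"
  unfolding transpose_mat1
proof (subst mat1_mult_selection)
  show "mat1 n n (\<lambda>i j. if \<sigma> j = \<sigma> i then 1 else 0 :: real) = 1\<^sub>m n"
    unfolding one_mat1 using assms(2) by (intro mat1_eqI) (auto dest: inj_onD)
qed (use assms(1) in auto)

subsection \<open>Diagonal minus rank one\<close>

interpretation of_real_poly_hom: map_poly_idom_hom "of_real :: real \<Rightarrow> complex" ..

text \<open>The matrix of this locale is a diagonal matrix minus a matrix of rank one. Because of the
  normalization, its secular function is, up to the factor \<open>t - \<mu> r\<close>, the function
  \<open>\<Sum>j. (s j)\<^sup>2 / (t - \<mu> j)\<close> in which the omitted index \<open>r\<close> takes part. All weights of this function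
  are positive, so its zeros are real and simple.\<close>

locale secular =
  fixes m r :: nat and \<kappa> :: real and \<mu> s :: "nat \<Rightarrow> real"
  assumes r_notin: "r \<notin> {1..m}"
    and inj_\<mu>: "inj_on \<mu> (insert r {1..m})"
    and s_pos: "k \<in> insert r {1..m} \<Longrightarrow> s k > 0"
    and \<kappa>_pos: "\<kappa> > 0"
    and normalized: "\<kappa> * (\<Sum>k \<in> insert r {1..m}. (s k)\<^sup>2) = 1"
begin

definition "I = insert r {1..m}"

text \<open>Common form of \<open>F_poly\<close> and \<open>G_poly\<close>; \<open>r\<close> is the
  index whose value is subtracted in the weights.\<close>

definition sec_poly :: "real poly" where
  "sec_poly = (\<Prod>j = 1..m. [:- \<mu> j, 1:]) + Polynomial.smult \<kappa>
     (\<Sum>j = 1..m. Polynomial.smult ((s j)\<^sup>2 * (\<mu> j - \<mu> r)) (\<Prod>i \<in> {1..m} - {j}. [:- \<mu> i, 1:]))"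

definition sec_mat :: "real mat" where
  "sec_mat = mat1 m m (\<lambda>k l. (if k = l then \<mu> k else 0) - \<kappa> * ((\<mu> k - \<mu> r) * s k) * s l)"

text \<open>For a matrix \<open>D - \<kappa> u s^T\<close> with \<open>D\<close> diagonal, an
  eigenvector to the eigenvalue \<open>t\<close> is \<open>(D - t)^(-1) u\<close>. Column
  \<open>l\<close> is this vector for \<open>u k = (\<mu> k - \<mu> r) * s k\<close> and
  \<open>t = \<phi> l\<close>.\<close>

definition eigen_mat :: "(nat \<Rightarrow> complex) \<Rightarrow> complex mat" where
  "eigen_mat \<phi> = mat1 m m (\<lambda>k l. complex_of_real ((\<mu> k - \<mu> r) * s k) / (complex_of_real (\<mu> k) - \<phi> l))"

lemma finite_I: "finite I" by (simp add: I_def)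

text \<open>Multiplying the leading product by 1, written as the normalization, gives every index of
  \<open>I\<close> a share of it. The result is symmetric in all indices, including
  \<open>r\<close>: the secular function with its denominators cleared.\<close>

lemma poly_sec_poly:
  "poly (cpoly sec_poly) t = of_real \<kappa> * (\<Sum>j \<in> I. of_real ((s j)\<^sup>2) * (\<Prod>i \<in> I - {j}. t - of_real (\<mu> i)))"
proof -
  let ?c = complex_of_real
  define Q where "Q = (\<Prod>j = 1..m. t - ?c (\<mu> j))"
  define Q' where "Q' j = (\<Prod>i \<in> {1..m} - {j}. t - ?c (\<mu> i))" for j
  have "poly (cpoly sec_poly) t = Q + ?c \<kappa> * (\<Sum>j = 1..m. ?c ((s j)\<^sup>2 * (\<mu> j - \<mu> r)) * Q' j)"
    unfolding sec_poly_def Q_def Q'_def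
    by (simp add: of_real_poly_hom.hom_add of_real_hom.map_poly_hom_smult
        of_real_poly_hom.hom_sum of_real_poly_hom.hom_prod poly_prod poly_sum)
  also have "Q = ?c (\<kappa> * (\<Sum>k \<in> insert r {1..m}. (s k)\<^sup>2)) * Q"
    by (simp only: normalized of_real_1 mult_1)
  also have "\<dots> = ?c \<kappa> * (?c ((s r)\<^sup>2) * Q + (\<Sum>j = 1..m. ?c ((s j)\<^sup>2) * Q))"
    unfolding sum_distrib_right[symmetric] using r_notin
    by (simp add: distrib_left distrib_right mult_ac)
  also have "\<dots> + ?c \<kappa> * (\<Sum>j = 1..m. ?c ((s j)\<^sup>2 * (\<mu> j - \<mu> r)) * Q' j)
    = ?c \<kappa> * (?c ((s r)\<^sup>2) * Q + (\<Sum>j = 1..m. ?c ((s j)\<^sup>2) * (Q + ?c (\<mu> j - \<mu> r) * Q' j)))"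
    by (simp add: distrib_left sum.distrib mult_ac)
  also have "(\<Sum>j = 1..m. ?c ((s j)\<^sup>2) * (Q + ?c (\<mu> j - \<mu> r) * Q' j))
    = (\<Sum>j = 1..m. ?c ((s j)\<^sup>2) * (\<Prod>i \<in> I - {j}. t - ?c (\<mu> i)))"
  proof (rule sum.cong[OF refl])
    fix j assume j: "j \<in> {1..m}"
    have 1: "Q = (t - ?c (\<mu> j)) * Q' j" unfolding Q_def Q'_def by (subst prod.remove[OF _ j]) auto
    have "I - {j} = insert r ({1..m} - {j})" using r_notin j by (auto simp: I_def)
    then have 2: "(\<Prod>i \<in> I - {j}. t - ?c (\<mu> i)) = (t - ?c (\<mu> r)) * Q' j"
      unfolding Q'_def using r_notin by (subst prod.insert[symmetric]) auto
    \<comment> \<open>Both terms contain \<open>Q' j\<close>, and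
      \<open>(t - \<mu> j) + (\<mu> j - \<mu> r) = t - \<mu> r\<close> restores the factor of the
      omitted index.\<close>
    show "?c ((s j)\<^sup>2) * (Q + ?c (\<mu> j - \<mu> r) * Q' j)
      = ?c ((s j)\<^sup>2) * (\<Prod>i \<in> I - {j}. t - ?c (\<mu> i))"
      unfolding 1 2 by (simp add: algebra_simps)
  qed
  also have "?c ((s r)\<^sup>2) * Q + \<dots> = (\<Sum>j \<in> I. ?c ((s j)\<^sup>2) * (\<Prod>i \<in> I - {j}. t - ?c (\<mu> i)))"
    using r_notin by (simp add: I_def Q_def)
  finally show ?thesis .
qed

section \<open>Location and simplicity of the zeros\<close>

text \<open>At \<open>\<mu> k\<close> every summand of \<open>poly_sec_poly\<close> except the
  \<open>k\<close>-th vanishes, and that one is a positive weight times a product of nonzero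
  differences.\<close>

lemma root_neq:
  assumes "poly (cpoly sec_poly) t = 0" "k \<in> I"
  shows "t \<noteq> of_real (\<mu> k)"
proof
  assume t: "t = of_real (\<mu> k)"
  have "(\<Sum>j \<in> I. complex_of_real ((s j)\<^sup>2) * (\<Prod>i \<in> I - {j}. t - of_real (\<mu> i)))
    = (\<Sum>j \<in> {k}. complex_of_real ((s j)\<^sup>2) * (\<Prod>i \<in> I - {j}. t - of_real (\<mu> i)))"
    using finite_I assms(2) t by (intro sum.mono_neutral_right) (auto intro!: prod_zero)
  moreover have "(\<Prod>i \<in> I - {k}. t - of_real (\<mu> i)) \<noteq> 0"
    using finite_I inj_onD[OF inj_\<mu>, folded I_def, OF _ assms(2)] by (auto simp: t)
  moreover have "s k \<noteq> 0" using s_pos[of k] assms(2) by (simp add: I_def)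
  ultimately show False using assms(1) \<kappa>_pos unfolding poly_sec_poly by simp
qed

lemma sec_poly_neq_0: "cpoly sec_poly \<noteq> 0"
  using root_neq[of "of_real (\<mu> r)" r] by (auto simp: I_def)

lemma poly_sec_poly_secular:
  assumes "\<And>k. k \<in> I \<Longrightarrow> t \<noteq> of_real (\<mu> k)"
  shows "poly (cpoly sec_poly) t = of_real \<kappa> *
    (poly (\<Prod>i \<in> I. [:- of_real (\<mu> i), 1:]) t * (\<Sum>j \<in> I. of_real ((s j)\<^sup>2) / (t - of_real (\<mu> j))))"
proof -
  have "of_real ((s j)\<^sup>2) * (\<Prod>i \<in> I - {j}. t - complex_of_real (\<mu> i))
    = (\<Prod>i \<in> I. t - of_real (\<mu> i)) * (of_real ((s j)\<^sup>2) / (t - of_real (\<mu> j)))" if "j \<in> I" for j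
    using assms[OF that] by (simp add: prod.remove[OF finite_I that])
  then show ?thesis unfolding poly_sec_poly by (simp add: sum_distrib_left poly_prod)
qed

lemma root_sum_eq_0:
  assumes "poly (cpoly sec_poly) t = 0"
  shows "(\<Sum>j \<in> I. of_real ((s j)\<^sup>2) / (t - of_real (\<mu> j))) = 0"
proof -
  note neq = root_neq[OF assms]
  have "poly (\<Prod>i \<in> I. [:- of_real (\<mu> i), 1:]) t \<noteq> 0" using neq finite_I by (auto simp: poly_prod)
  with poly_sec_poly_secular[OF neq] assms \<kappa>_pos show ?thesis by simp
qed

text \<open>The imaginary part of the secular function is \<open>- Im t\<close> times a sum of
  positive terms, so it can vanish only for real \<open>t\<close>.\<close>

lemma root_real:
  assumes "poly (cpoly sec_poly) t = 0"
  shows "t \<in> \<real>"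
proof -
  have "Im (of_real ((s j)\<^sup>2) / (t - of_real (\<mu> j))) = - Im t * ((s j)\<^sup>2 / (cmod (t - of_real (\<mu> j)))\<^sup>2)" for j
    by (simp add: Im_divide cmod_power2)
  then have "Im (\<Sum>j \<in> I. of_real ((s j)\<^sup>2) / (t - of_real (\<mu> j)))
    = - Im t * (\<Sum>j \<in> I. (s j)\<^sup>2 / (cmod (t - of_real (\<mu> j)))\<^sup>2)"
    by (simp add: sum_distrib_left)
  moreover have "(\<Sum>j \<in> I. (s j)\<^sup>2 / (cmod (t - of_real (\<mu> j)))\<^sup>2) > 0"
    using root_neq[OF assms] s_pos finite_I
    by (intro sum_pos) (force simp: I_def intro!: divide_pos_pos)+
  ultimately show ?thesis unfolding root_sum_eq_0[OF assms] by (simp add: complex_is_Real_iff)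
qed

text \<open>Since \<open>t\<close> is real, all summands are positive. Up to sign the sum is the
  derivative of the secular function; it gives simplicity of the zeros and, later, nonzero diagonal
  entries in the proof that \<open>eigen_mat\<close> is invertible.\<close>

lemma root_sum_squares_neq_0:
  assumes "poly (cpoly sec_poly) t = 0"
  shows "(\<Sum>j \<in> I. of_real ((s j)\<^sup>2) / (t - of_real (\<mu> j))\<^sup>2) \<noteq> 0"
proof -
  obtain x where x: "t = of_real x" using root_real[OF assms] by (elim Reals_cases)
  have "(\<Sum>j \<in> I. (s j)\<^sup>2 / (x - \<mu> j)\<^sup>2) > 0"
    using root_neq[OF assms] s_pos finite_I
    by (intro sum_pos) (force simp: I_def x intro!: divide_pos_pos)+
  moreover have "(\<Sum>j \<in> I. of_real ((s j)\<^sup>2) / (t - of_real (\<mu> j))\<^sup>2) = complex_of_real (\<Sum>j \<in> I. (s j)\<^sup>2 / (x - \<mu> j)\<^sup>2)"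
    by (simp add: x)
  ultimately show ?thesis by (metis less_irrefl of_real_eq_0_iff)
qed

text \<open>Off the poles the polynomial is \<open>\<kappa> * A * g\<close> with the secular
  function \<open>g\<close>. At a zero the product rule leaves only
  \<open>\<kappa> * A * g'\<close>, as \<open>g\<close> vanishes there.\<close>

lemma root_pderiv_neq_0:
  assumes "poly (cpoly sec_poly) t = 0"
  shows "poly (pderiv (cpoly sec_poly)) t \<noteq> 0"
proof -
  define A where "A = (\<Prod>i \<in> I. [:- complex_of_real (\<mu> i), 1:])"
  define g where "g u = (\<Sum>j \<in> I. of_real ((s j)\<^sup>2) / (u - of_real (\<mu> j)))" for u :: complex
  define g' where "g' = - (\<Sum>j \<in> I. of_real ((s j)\<^sup>2) / (t - of_real (\<mu> j))\<^sup>2)"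
  note neq = root_neq[OF assms]
  have "((\<lambda>u. of_real ((s j)\<^sup>2) / (u - of_real (\<mu> j))) has_field_derivative
      - (of_real ((s j)\<^sup>2) / (t - of_real (\<mu> j))\<^sup>2)) (at t)" if "j \<in> I" for j
    using neq[OF that] by (auto intro!: derivative_eq_intros simp: power2_eq_square)
  then have "(g has_field_derivative g') (at t)"
    unfolding g_def g'_def sum_negf[symmetric] by (intro DERIV_sum) auto
  then have "((\<lambda>u. of_real \<kappa> * (poly A u * g u)) has_field_derivative
      of_real \<kappa> * (poly (pderiv A) t * g t + poly A t * g')) (at t)"
    by (auto intro!: derivative_eq_intros)
  \<comment> \<open>The factorization fails only at the finitely many poles, so it holds on an open
    set around \<open>t\<close> and the derivative carries over.\<close>
  moreover have "open (- (\<lambda>k. complex_of_real (\<mu> k)) ` I)"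
    using finite_I by (intro open_Compl finite_imp_closed) auto
  ultimately have "(poly (cpoly sec_poly) has_field_derivative
      of_real \<kappa> * (poly (pderiv A) t * g t + poly A t * g')) (at t)"
  proof (rule has_field_derivative_transform_within_open)
    fix u assume "u \<in> - (\<lambda>k. complex_of_real (\<mu> k)) ` I"
    then show "of_real \<kappa> * (poly A u * g u) = poly (cpoly sec_poly) u"
      unfolding A_def g_def by (subst poly_sec_poly_secular) auto
  qed (use neq in auto)
  then have "poly (pderiv (cpoly sec_poly)) t = of_real \<kappa> * (poly (pderiv A) t * g t + poly A t * g')"
    using poly_DERIV DERIV_unique by blast
  moreover have "g t = 0" using root_sum_eq_0[OF assms] by (simp add: g_def)
  moreover have "g' \<noteq> 0" using root_sum_squares_neq_0[OF assms] by (simp add: g'_def)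
  moreover have "poly A t \<noteq> 0" using neq finite_I by (auto simp: A_def poly_prod)
  ultimately show ?thesis using \<kappa>_pos by simp
qed

section \<open>Eigenvectors attached to a list of the zeros\<close>

context
  fixes \<phi> :: "nat \<Rightarrow> complex"
  assumes zeros: "lists_zeros sec_poly m \<phi>"
begin

lemma zeros_root: "i \<in> {1..m} \<Longrightarrow> poly (cpoly sec_poly) (\<phi> i) = 0"
proof -
  assume "i \<in> {1..m}"
  then have "\<phi> i \<in># image_mset \<phi> (mset_set {1..m})" by auto
  then have "\<phi> i \<in># proots (cpoly sec_poly)" using zeros unfolding lists_zeros_def by metis
  then show ?thesis using sec_poly_neq_0 by simp
qed

text \<open>The list counts multiplicities, so a value at two positions would be a zero of order at
  least 2, contradicting the nonzero derivative.\<close>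

lemma zeros_distinct: "inj_on \<phi> {1..m}"
proof (rule inj_onI, rule ccontr)
  fix i j assume ij: "i \<in> {1..m}" "j \<in> {1..m}" "\<phi> i = \<phi> j" "i \<noteq> j"
  let ?p = "cpoly sec_poly"
  have "{#i, j#} \<subseteq># mset_set {1..m}"
    using ij subset_imp_msubset_mset_set[of "{i, j}" "{1..m}"] by simp
  then have "image_mset \<phi> {#i, j#} \<subseteq># proots ?p"
    using zeros image_mset_subseteq_mono unfolding lists_zeros_def by metis
  then have "count (image_mset \<phi> {#i, j#}) (\<phi> i) \<le> count (proots ?p) (\<phi> i)"
    by (rule mset_subset_eq_count)
  then have two: "order (\<phi> i) ?p \<ge> 2" using ij sec_poly_neq_0 by simp
  have nz: "poly (pderiv ?p) (\<phi> i) \<noteq> 0" using root_pderiv_neq_0 zeros_root ij by blast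
  then have "order (\<phi> i) ?p = Suc (order (\<phi> i) (pderiv ?p))"
    using two zeros_root ij by (intro order_pderiv) auto
  with two have "order (\<phi> i) (pderiv ?p) \<noteq> 0" by simp
  with nz show False by (simp add: order_root)
qed

lemma zeros_neq: "i \<in> {1..m} \<Longrightarrow> k \<in> I \<Longrightarrow> complex_of_real (\<mu> k) - \<phi> i \<noteq> 0"
  using root_neq zeros_root by fastforce

lemma zeros_sum: "l \<in> {1..m} \<Longrightarrow> (\<Sum>k \<in> I. of_real ((s k)\<^sup>2) / (of_real (\<mu> k) - \<phi> l)) = 0"
proof -
  assume l: "l \<in> {1..m}"
  have "(\<Sum>k \<in> I. of_real ((s k)\<^sup>2) / (of_real (\<mu> k) - \<phi> l))
    = - (\<Sum>k \<in> I. of_real ((s k)\<^sup>2) / (\<phi> l - of_real (\<mu> k)))"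
    unfolding sum_negf[symmetric] by (intro sum.cong refl) (metis minus_diff_eq divide_minus_right)
  then show ?thesis using root_sum_eq_0[OF zeros_root[OF l]] by simp
qed

text \<open>For different zeros, partial fractions give the difference of two vanishing secular
  sums, divided by \<open>\<phi> i - \<phi> l\<close>. For equal ones the sum of squares remains,
  which is nonzero.\<close>

lemma zeros_sum_mult:
  assumes "i \<in> {1..m}" "l \<in> {1..m}"
  shows "(\<Sum>k \<in> I. complex_of_real ((s k)\<^sup>2) / ((of_real (\<mu> k) - \<phi> i) * (of_real (\<mu> k) - \<phi> l))) = 0
    \<longleftrightarrow> i \<noteq> l"
proof (cases "i = l")
  case True
  then show ?thesis using root_sum_squares_neq_0[OF zeros_root[OF assms(1)]]
    by (simp add: power2_eq_square[symmetric] power2_commute[of "\<phi> l"])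
next
  case False
  then have ne: "\<phi> i \<noteq> \<phi> l" using zeros_distinct assms by (auto dest: inj_onD)
  have "complex_of_real ((s k)\<^sup>2) / ((of_real (\<mu> k) - \<phi> i) * (of_real (\<mu> k) - \<phi> l))
    = (of_real ((s k)\<^sup>2) / (of_real (\<mu> k) - \<phi> i) - of_real ((s k)\<^sup>2) / (of_real (\<mu> k) - \<phi> l)) / (\<phi> i - \<phi> l)"
    if "k \<in> I" for k
  proof -
    have "v / (x * y) = (v / x - v / y) / (y - x)" if "x \<noteq> 0" "y \<noteq> 0" "y - x \<noteq> 0" for v x y :: complex
      using that by (simp add: field_simps)
    from this[OF zeros_neq[OF assms(1) that] zeros_neq[OF assms(2) that]] ne show ?thesis by simp
  qed
  then show ?thesis using zeros_sum assms False
    by (simp add: sum_divide_distrib[symmetric] sum_subtractf)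
qed

text \<open>The factor \<open>\<mu> k - \<mu> r\<close> kills the term at \<open>r\<close>. Matrix
  products run over \<open>{1..m}\<close>, whereas the secular equation runs over \<open>I\<close>;
  this passes between them.\<close>

lemma sum_I_eq: "(\<Sum>k \<in> I. of_real (\<mu> k - \<mu> r) * f k) = (\<Sum>k = 1..m. of_real (\<mu> k - \<mu> r) * (f k :: complex))"
  using r_notin by (simp add: I_def)

text \<open>With \<open>u\<close>, \<open>D\<close> and a column
  \<open>w = (D - \<phi> l)^(-1) u\<close>, one has \<open>D w = \<phi> l w + u\<close>. The
  rank-one part subtracts exactly \<open>u\<close>, because \<open>\<kappa>\<close> times the inner
  product of \<open>s\<close> and \<open>w\<close> is 1.\<close>

lemma sec_mat_eigen_mat:
  "cmat sec_mat * eigen_mat \<phi> = eigen_mat \<phi> * mat_diag m (\<lambda>i. \<phi> (Suc i))"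
proof -
  let ?c = complex_of_real
  have "cmat sec_mat = mat1 m m (\<lambda>k l. ?c ((if k = l then \<mu> k else 0) - \<kappa> * ((\<mu> k - \<mu> r) * s k) * s l))"
    by (rule eq_matI) (auto simp: sec_mat_def mat1_def)
  moreover have "(\<Sum>k = 1..m. ?c ((if i = k then \<mu> i else 0) - \<kappa> * ((\<mu> i - \<mu> r) * s i) * s k)
      * (?c ((\<mu> k - \<mu> r) * s k) / (?c (\<mu> k) - \<phi> l)))
    = (\<Sum>k = 1..m. ?c ((\<mu> i - \<mu> r) * s i) / (?c (\<mu> i) - \<phi> k) * (if k = l then \<phi> (Suc (k - 1)) else 0))"
    if i: "i \<in> {1..m}" and l: "l \<in> {1..m}" for i l
  proof -
    let ?w = "?c ((\<mu> i - \<mu> r) * s i)"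
    \<comment> \<open>Split \<open>\<mu> k - \<mu> r\<close> as
      \<open>(\<mu> k - \<phi> l) + (\<phi> l - \<mu> r)\<close>: the first part leaves the sum of
      the squared weights, the second a multiple of the secular sum, which is 0.\<close>
    have "(\<Sum>k = 1..m. ?c (\<mu> k - \<mu> r) * (?c ((s k)\<^sup>2) / (?c (\<mu> k) - \<phi> l)))
      = (\<Sum>k \<in> I. ?c ((s k)\<^sup>2) + (\<phi> l - ?c (\<mu> r)) * (?c ((s k)\<^sup>2) / (?c (\<mu> k) - \<phi> l)))"
      unfolding sum_I_eq[symmetric]
    proof (rule sum.cong[OF refl])
      fix k assume "k \<in> I"
      from zeros_neq[OF l this] show "?c (\<mu> k - \<mu> r) * (?c ((s k)\<^sup>2) / (?c (\<mu> k) - \<phi> l))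
        = ?c ((s k)\<^sup>2) + (\<phi> l - ?c (\<mu> r)) * (?c ((s k)\<^sup>2) / (?c (\<mu> k) - \<phi> l))"
        by (simp add: field_simps)
    qed
    also have "\<dots> = ?c (\<Sum>k \<in> I. (s k)\<^sup>2)"
      using zeros_sum[OF l]
      by (simp add: sum.distrib sum_distrib_left[symmetric] del: times_divide_eq_right of_real_power)
    finally have *: "?c \<kappa> * (\<Sum>k = 1..m. ?c (\<mu> k - \<mu> r) * (?c ((s k)\<^sup>2) / (?c (\<mu> k) - \<phi> l))) = 1"
      unfolding I_def by (simp only: normalized of_real_1 flip: of_real_mult)
    have "(\<Sum>k = 1..m. ?c ((if i = k then \<mu> i else 0) - \<kappa> * ((\<mu> i - \<mu> r) * s i) * s k)
        * (?c ((\<mu> k - \<mu> r) * s k) / (?c (\<mu> k) - \<phi> l)))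
      = (\<Sum>k = 1..m. (if i = k then ?c (\<mu> i) * (?w / (?c (\<mu> i) - \<phi> l)) else 0)
        - ?w * (?c \<kappa> * (?c (\<mu> k - \<mu> r) * (?c ((s k)\<^sup>2) / (?c (\<mu> k) - \<phi> l)))))"
    proof (rule sum.cong[OF refl])
      fix k
      have "(e - K * w * u) * (a * u / D) = e * (a * u / D) - w * (K * (a * (u\<^sup>2 / D)))"
        for e K w u a D :: complex
        by (simp add: left_diff_distrib right_diff_distrib diff_divide_distrib power2_eq_square mult_ac)
      from this[of "if i = k then ?c (\<mu> i) else 0" "?c \<kappa>" ?w "?c (s k)" "?c (\<mu> k - \<mu> r)" "?c (\<mu> k) - \<phi> l"]
      show "?c ((if i = k then \<mu> i else 0) - \<kappa> * ((\<mu> i - \<mu> r) * s i) * s k)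
          * (?c ((\<mu> k - \<mu> r) * s k) / (?c (\<mu> k) - \<phi> l))
        = (if i = k then ?c (\<mu> i) * (?w / (?c (\<mu> i) - \<phi> l)) else 0)
          - ?w * (?c \<kappa> * (?c (\<mu> k - \<mu> r) * (?c ((s k)\<^sup>2) / (?c (\<mu> k) - \<phi> l))))"
        by (cases "i = k") (simp_all only: of_real_diff of_real_mult of_real_power of_real_0 simp_thms if_True if_False mult_zero_left)
    qed
    also have "\<dots> = ?c (\<mu> i) * (?w / (?c (\<mu> i) - \<phi> l)) - ?w"
      unfolding sum_subtractf sum_distrib_left[symmetric] * using i by simp
    also have "\<dots> = ?w / (?c (\<mu> i) - \<phi> l) * \<phi> l"
      using zeros_neq[OF l, of i] i by (simp add: I_def field_simps)
    also have "\<dots> = (\<Sum>k = 1..m. ?w / (?c (\<mu> i) - \<phi> k) * (if k = l then \<phi> (Suc (k - 1)) else 0))"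
      using l by (simp add: if_distrib[of "(*) _"] cong: if_cong)
    finally show ?thesis .
  qed
  ultimately show ?thesis
    unfolding eigen_mat_def mat_diag_mat1 by (simp only: mat1_mult) (rule mat1_eqI)
qed

lemma invertible_eigen_mat: "invertible_mat (eigen_mat \<phi>)"
proof -
  (* Left multiplication by this Cauchy matrix diagonalizes: off the diagonal, partial fractions
     reduce each entry to values of the secular function at its zeros. *)
  let ?c = complex_of_real
  define L where "L = mat1 m m (\<lambda>i k. ?c (s k) / (?c (\<mu> k) - \<phi> i))"
  define N where "N i l = (\<Sum>k \<in> I. ?c ((s k)\<^sup>2) / ((?c (\<mu> k) - \<phi> i) * (?c (\<mu> k) - \<phi> l)))" for i l
  define d where "d i = (\<phi> (Suc i) - ?c (\<mu> r)) * N (Suc i) (Suc i)" for i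
  have "(\<Sum>k = 1..m. ?c (s k) / (?c (\<mu> k) - \<phi> i) * (?c ((\<mu> k - \<mu> r) * s k) / (?c (\<mu> k) - \<phi> l)))
    = (if i = l then d (i - 1) else 0)" if il: "i \<in> {1..m}" "l \<in> {1..m}" for i l
  proof -
    have "(\<Sum>k = 1..m. ?c (s k) / (?c (\<mu> k) - \<phi> i) * (?c ((\<mu> k - \<mu> r) * s k) / (?c (\<mu> k) - \<phi> l)))
      = (\<Sum>k = 1..m. ?c (\<mu> k - \<mu> r) * (?c ((s k)\<^sup>2) / ((?c (\<mu> k) - \<phi> i) * (?c (\<mu> k) - \<phi> l))))"
      by (intro sum.cong refl) (simp add: power2_eq_square mult_ac)
    \<comment> \<open>Here \<open>\<mu> k - \<mu> r\<close> is split at \<open>\<phi> i\<close>; the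
      part that cancels a denominator sums to 0 by the secular equation for
      \<open>\<phi> l\<close>.\<close>
    also have "\<dots> = (\<Sum>k \<in> I. ?c ((s k)\<^sup>2) / (?c (\<mu> k) - \<phi> l)
      + (\<phi> i - ?c (\<mu> r)) * (?c ((s k)\<^sup>2) / ((?c (\<mu> k) - \<phi> i) * (?c (\<mu> k) - \<phi> l))))"
      unfolding sum_I_eq[symmetric]
    proof (rule sum.cong[OF refl])
      fix k assume k: "k \<in> I"
      have "(x - y) * (v / ((x - a) * z)) = v / z + (a - y) * (v / ((x - a) * z))"
        if "x - a \<noteq> 0" "z \<noteq> 0" for x y v a z :: complex
        using that by (simp add: field_simps)
      from this[OF zeros_neq[OF il(1) k] zeros_neq[OF il(2) k]]
      show "?c (\<mu> k - \<mu> r) * (?c ((s k)\<^sup>2) / ((?c (\<mu> k) - \<phi> i) * (?c (\<mu> k) - \<phi> l)))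
        = ?c ((s k)\<^sup>2) / (?c (\<mu> k) - \<phi> l)
        + (\<phi> i - ?c (\<mu> r)) * (?c ((s k)\<^sup>2) / ((?c (\<mu> k) - \<phi> i) * (?c (\<mu> k) - \<phi> l)))"
        by simp
    qed
    also have "\<dots> = (\<phi> i - ?c (\<mu> r)) * N i l"
      using zeros_sum[OF il(2)] by (simp add: N_def sum.distrib sum_distrib_left)
    also have "\<dots> = (if i = l then d (i - 1) else 0)"
      using zeros_sum_mult[OF il] il by (auto simp: d_def N_def)
    finally show ?thesis .
  qed
  then have LF: "L * eigen_mat \<phi> = mat_diag m d"
    unfolding L_def eigen_mat_def mat_diag_mat1 mat1_mult by (rule mat1_eqI)
  \<comment> \<open>As \<open>r\<close> belongs to \<open>I\<close>, no zero equals
    \<open>\<mu> r\<close>, and \<open>N\<close> does not vanish on the diagonal.\<close>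
  have d: "d i \<noteq> 0" if "i < m" for i
    using zeros_neq[of "Suc i" r] zeros_sum_mult[of "Suc i" "Suc i"] that by (auto simp: d_def N_def I_def)
  have c: "L \<in> carrier_mat m m" "eigen_mat \<phi> \<in> carrier_mat m m"
    by (simp_all add: L_def eigen_mat_def)
  define B where "B = mat_diag m (\<lambda>i. 1 / d i) * L"
  have B: "B \<in> carrier_mat m m" unfolding B_def by (rule mult_carrier_mat[OF mat_diag_dim c(1)])
  have "B * eigen_mat \<phi> = mat_diag m (\<lambda>i. 1 / d i) * mat_diag m d"
    unfolding B_def LF[symmetric] by (rule assoc_mult_mat[OF mat_diag_dim c])
  also have "\<dots> = 1\<^sub>m m"
    unfolding mat_diag_diag using d by (intro eq_matI) (auto simp: mat_diag_def)
  finally have "B * eigen_mat \<phi> = 1\<^sub>m m" .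
  moreover from mat_mult_left_right_inverse[OF B c(2) this] have "eigen_mat \<phi> * B = 1\<^sub>m m" .
  ultimately show ?thesis using c B
    by (auto simp: invertible_mat_def inverts_mat_def square_mat.simps)
qed

end

end

subsection \<open>Splitting into odd and even indices\<close>

text \<open>The inserted indices \<open>0\<close> and \<open>n div 2 + 1\<close> stand for index 1
  and the largest even index, whose columns are eliminated later.\<close>

lemma sum_parity_split:
  fixes f :: "nat \<Rightarrow> 'a :: comm_monoid_add"
  shows "(\<Sum>m = 1..n + 2. f m) = (\<Sum>k \<in> insert 0 {1..(n + 1) div 2}. f (2 * k + 1))
    + (\<Sum>k \<in> insert (n div 2 + 1) {1..n div 2}. f (2 * k))"
proof -
  let ?A = "(\<lambda>k. 2 * k + 1) ` insert 0 {1..(n + 1) div 2}"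
  let ?B = "(\<lambda>k. 2 * k) ` insert (n div 2 + 1) {1..n div 2}"
  have "m \<in> ?A \<union> ?B" if "m \<in> {1..n + 2}" for m
  proof (cases "even m")
    case True
    then obtain k where "m = 2 * k" by (elim evenE)
    with that show ?thesis by (intro UnI2 image_eqI[of _ _ k]) auto
  next
    case False
    then obtain k where "m = 2 * k + 1" by (elim oddE)
    with that show ?thesis by (intro UnI1 image_eqI[of _ _ k]) auto
  qed
  moreover have "?A \<union> ?B \<subseteq> {1..n + 2}" by auto
  ultimately have U: "{1..n + 2} = ?A \<union> ?B" by blast
  have D: "?A \<inter> ?B = {}" by (auto dest: arg_cong[of _ _ even])
  have "(\<Sum>m = 1..n + 2. f m) = sum f ?A + sum f ?B"
    unfolding U by (rule sum.union_disjoint[OF _ _ D]) auto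
  also have "sum f ?A = (\<Sum>k \<in> insert 0 {1..(n + 1) div 2}. f (2 * k + 1))"
    by (subst sum.reindex) (auto simp: inj_on_def)
  also have "sum f ?B = (\<Sum>k \<in> insert (n div 2 + 1) {1..n div 2}. f (2 * k))"
    by (subst sum.reindex) (auto simp: inj_on_def)
  finally show ?thesis .
qed

text \<open>Subtracting \<open>\<mu> r\<close> times the linear relation from the weighted sum
  removes the term at \<open>r\<close> and turns each \<open>\<mu> k\<close> into
  \<open>\<mu> k - \<mu> r\<close>.\<close>

lemma sum_rank_one_column:
  fixes \<mu> s v :: "nat \<Rightarrow> real"
  assumes "r \<notin> {1..m}" "(\<Sum>k \<in> insert r {1..m}. s k * v k) = 0" "l \<in> {1..m}"
  shows "\<mu> l * v l - \<kappa> * s l * (\<Sum>k \<in> insert r {1..m}. \<mu> k * (s k * v k))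
    = (\<Sum>k = 1..m. v k * ((if k = l then \<mu> k else 0) - \<kappa> * ((\<mu> k - \<mu> r) * s k) * s l))"
proof -
  have "(\<Sum>k \<in> insert r {1..m}. \<mu> k * (s k * v k))
    = (\<Sum>k \<in> insert r {1..m}. \<mu> k * (s k * v k)) - \<mu> r * (\<Sum>k \<in> insert r {1..m}. s k * v k)"
    by (simp only: assms(2) mult_zero_right diff_zero)
  also have "\<dots> = (\<Sum>k \<in> insert r {1..m}. (\<mu> k - \<mu> r) * (s k * v k))"
    by (simp only: left_diff_distrib sum_subtractf sum_distrib_left)
  also have "\<dots> = (\<Sum>k = 1..m. (\<mu> k - \<mu> r) * (s k * v k))"
    using assms(1) by simp
  finally have "\<mu> l * v l - \<kappa> * s l * (\<Sum>k \<in> insert r {1..m}. \<mu> k * (s k * v k))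
    = (\<Sum>k = 1..m. if k = l then v k * \<mu> k else 0) - (\<Sum>k = 1..m. \<kappa> * s l * ((\<mu> k - \<mu> r) * (s k * v k)))"
    using assms(3) by (simp add: sum_distrib_left mult.commute)
  also have "\<dots> = (\<Sum>k = 1..m. v k * ((if k = l then \<mu> k else 0) - \<kappa> * ((\<mu> k - \<mu> r) * s k) * s l))"
    unfolding sum_subtractf[symmetric] by (intro sum.cong refl) (simp add: algebra_simps)
  finally show ?thesis .
qed

text \<open>The relation expresses \<open>v r\<close> through the other \<open>v k\<close>, so the
  term \<open>v r * u r\<close> can be distributed over the remaining indices.\<close>

lemma sum_eliminate:
  fixes s u v :: "nat \<Rightarrow> real"
  assumes "r \<notin> {1..m}" "(\<Sum>k \<in> insert r {1..m}. s k * v k) = 0" "s r \<noteq> 0"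
  shows "(\<Sum>k = 1..m. v k * (u k - s k / s r * u r)) = (\<Sum>k \<in> insert r {1..m}. v k * u k)"
proof -
  have "(\<Sum>k = 1..m. v k * (u k - s k / s r * u r))
    = (\<Sum>k = 1..m. v k * u k) - (\<Sum>k = 1..m. s k * v k) * (u r / s r)"
    unfolding sum_distrib_right sum_subtractf[symmetric] by (intro sum.cong) (auto simp: algebra_simps)
  also have "(\<Sum>k = 1..m. s k * v k) = - (s r * v r)" using assms by simp
  finally show ?thesis using assms by simp
qed

section \<open>Orthogonality relations of the sine transform by parity\<close>

abbreviation sn :: "nat \<Rightarrow> nat \<Rightarrow> real" where
  "sn n m \<equiv> sin (real m * pi / (real n + 3))"

lemma sn_pos:
  assumes "m \<in> {1..n + 2}"
  shows "sn n m > 0"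
proof (rule sin_gt_zero)
  have "real m * pi < (real n + 3) * pi" using assms by (intro mult_strict_right_mono) auto
  then show "real m * pi / (real n + 3) < pi" by (simp add: pos_divide_less_eq mult.commute)
qed (use assms in auto)

lemma dst_1: "dst n 1 m = sqrt (2 / (real n + 3)) * sn n m"
  by (simp add: dst_def)

text \<open>The angle is \<open>m * pi\<close> minus that of the first row. Hence the sum of the
  first and last rows lives on odd columns and their difference on even ones.\<close>

lemma dst_last: "dst n (n + 2) m = (if even m then - 1 else 1) * dst n 1 m"
proof -
  have "real (n + 2) * real m * pi / (real n + 3) = real m * pi - real m * pi / (real n + 3)"
    by (simp add: field_simps)
  then have "sin (real (n + 2) * real m * pi / (real n + 3)) = - ((- 1) ^ m * sn n m)"
    by (simp add: sin_diff)
  then show ?thesis by (simp add: dst_def)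
qed

text \<open>The odd and even partial sums add up to the inner product of row \<open>i\<close> with
  the first row, and their difference is the one with the last row; both are known by
  orthonormality.\<close>

lemma sum_dst_first:
  assumes "i \<in> {1..n + 2}"
  shows "2 * (\<Sum>k \<in> insert 0 {1..(n + 1) div 2}. dst n 1 (2 * k + 1) * dst n i (2 * k + 1))
      = (if 1 = i then 1 else 0) + (if n + 2 = i then 1 else 0)" (is "2 * ?O = _")
    and "2 * (\<Sum>k \<in> insert (n div 2 + 1) {1..n div 2}. dst n 1 (2 * k) * dst n i (2 * k))
      = (if 1 = i then 1 else 0) - (if n + 2 = i then 1 else 0)" (is "2 * ?E = _")
proof -
  have "?O + ?E = (if 1 = i then 1 else 0)"
    using sum_dst_mult[of 1 n i] assms
    unfolding sum_parity_split[of "\<lambda>m. dst n 1 m * dst n i m"] by simp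
  moreover have "?O - ?E = (\<Sum>m = 1..n + 2. dst n (n + 2) m * dst n i m)"
    unfolding sum_parity_split dst_last diff_conv_add_uminus sum_negf[symmetric]
    by (intro arg_cong2[of _ _ _ _ "(+)"] sum.cong) auto
  moreover have "\<dots> = (if n + 2 = i then 1 else 0)"
    by (rule sum_dst_mult) (use assms in auto)
  ultimately show "2 * ?O = (if 1 = i then 1 else 0) + (if n + 2 = i then 1 else 0)"
    and "2 * ?E = (if 1 = i then 1 else 0) - (if n + 2 = i then 1 else 0)"
    by linarith+
qed

text \<open>For an inner row both right-hand sides of \<open>sum_dst_first\<close> vanish. These are
  the relations by which two columns are eliminated.\<close>

lemma sum_sn_dst:
  assumes "i \<in> {1..n}"
  shows "(\<Sum>k \<in> insert 0 {1..(n + 1) div 2}. sn n (2 * k + 1) * dst n (i + 1) (2 * k + 1)) = 0"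
    and "(\<Sum>k \<in> insert (n div 2 + 1) {1..n div 2}. sn n (2 * k) * dst n (i + 1) (2 * k)) = 0"
proof -
  have "i + 1 \<in> {1..n + 2}" "i + 1 \<noteq> 1" "i + 1 \<noteq> n + 2" using assms by auto
  with sum_dst_first[of "i + 1" n] show
    "(\<Sum>k \<in> insert 0 {1..(n + 1) div 2}. sn n (2 * k + 1) * dst n (i + 1) (2 * k + 1)) = 0"
    "(\<Sum>k \<in> insert (n div 2 + 1) {1..n div 2}. sn n (2 * k) * dst n (i + 1) (2 * k)) = 0"
    unfolding dst_1 mult.assoc sum_distrib_left[symmetric] by simp_all
qed

lemma dst_1_square: "(dst n 1 m)\<^sup>2 = 2 / (real n + 3) * (sn n m)\<^sup>2"
  by (simp only: dst_1 power_mult_distrib) simp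

text \<open>The case \<open>i = 1\<close> of \<open>sum_dst_first\<close> supplies the normalization
  required by the locale \<open>secular\<close>.\<close>

lemma sum_sn_squares:
  shows "4 / (real n + 3) * (\<Sum>k \<in> insert 0 {1..(n + 1) div 2}. (sn n (2 * k + 1))\<^sup>2) = 1"
    and "4 / (real n + 3) * (\<Sum>k \<in> insert (n div 2 + 1) {1..n div 2}. (sn n (2 * k))\<^sup>2) = 1"
  using sum_dst_first[of 1 n]
  unfolding power2_eq_square[symmetric] dst_1_square sum_distrib_left[symmetric] by simp_all

text \<open>By symmetry the columns over all rows are orthonormal. The removed first and last rows
  contribute equally when \<open>m\<close> and \<open>c\<close> have the same parity and cancel
  otherwise.\<close>

lemma sum_dst_inner:
  assumes "m \<in> {1..n + 2}" "c \<in> {1..n + 2}"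
  shows "(\<Sum>j = 1..n. dst n (j + 1) m * dst n (j + 1) c)
    = (if m = c then 1 else 0) - (if even (m + c) then 4 / (real n + 3) * sn n c * sn n m else 0)"
proof -
  define f where "f j = dst n j m * dst n j c" for j
  have "(\<Sum>j = 1..n + 2. f j) = (if m = c then 1 else 0)"
    using sum_dst_mult[OF assms] by (simp add: f_def dst_commute[of n _ m] dst_commute[of n _ c])
  moreover have "(\<Sum>j = 1..n + 2. f j) = f 1 + (\<Sum>j = 1..n. f (j + 1)) + f (n + 2)"
    using sum_atLeast1_add[of f 1 "n + 1"] by (simp add: add_ac)
  moreover have "f 1 + f (n + 2) = (if even (m + c) then 2 * (dst n 1 m * dst n 1 c) else 0)"
    unfolding f_def dst_last by (cases "even m"; cases "even c") simp_all
  ultimately have "(\<Sum>j = 1..n. f (j + 1))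
    = (if m = c then 1 else 0) - (if even (m + c) then 2 * (dst n 1 m * dst n 1 c) else 0)"
    by linarith
  moreover have "2 * (dst n 1 m * dst n 1 c) = 4 / (real n + 3) * sn n c * sn n m"
    unfolding dst_mult by simp
  ultimately show ?thesis unfolding f_def by simp
qed

text \<open>Write the Hankel matrix as the inner rows times diag(\<open>\<mu>\<close>) times their
  transpose. Applied to a column, this meets the Gram matrix of the columns, which by
  \<open>sum_dst_inner\<close> is the identity minus a rank-one matrix in each parity class.\<close>

lemma hankel_mult_dst:
  fixes a b c d :: real
  assumes "i \<in> {1..n}" "k \<in> {1..n + 2}"
  defines "\<mu> \<equiv> lam n a b c d"
  shows "(\<Sum>j = 1..n. hankel_mat n a b c d $$ (i - 1, j - 1) * dst n (j + 1) k)
    = \<mu> k * dst n (i + 1) k - 4 / (real n + 3) * sn n k *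
      (\<Sum>m = 1..n + 2. if even (m + k) then \<mu> m * (sn n m * dst n (i + 1) m) else 0)"
proof -
  have H: "hankel_mat n a b c d $$ (i - 1, j - 1) = (\<Sum>m = 1..n + 2. \<mu> m * (dst n (i + 1) m * dst n (j + 1) m))"
    if "j \<in> {1..n}" for j
  proof -
    have "i - 1 + 2 = i + 1" "j - 1 + 2 = j + 1" using assms(1) that by auto
    then show ?thesis
      using sum_lam_dst_mult[of "i - 1" n "j - 1" a b c d] assms(1) that by (simp add: \<mu>_def)
  qed
  have "(\<Sum>j = 1..n. hankel_mat n a b c d $$ (i - 1, j - 1) * dst n (j + 1) k)
    = (\<Sum>j = 1..n. \<Sum>m = 1..n + 2. \<mu> m * (dst n (i + 1) m * dst n (j + 1) m) * dst n (j + 1) k)"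
    by (intro sum.cong refl) (simp only: H sum_distrib_right)
  also have "\<dots> = (\<Sum>m = 1..n + 2. \<mu> m * dst n (i + 1) m * (\<Sum>j = 1..n. dst n (j + 1) m * dst n (j + 1) k))"
    by (subst sum.swap) (simp add: sum_distrib_left mult_ac)
  also have "\<dots> = (\<Sum>m = 1..n + 2. (if m = k then \<mu> m * dst n (i + 1) m else 0)
    - 4 / (real n + 3) * sn n k * (if even (m + k) then \<mu> m * (sn n m * dst n (i + 1) m) else 0))"
    
  proof (intro sum.cong refl)
    fix m assume "m \<in> {1..n + 2}"
    from sum_dst_inner[OF this assms(2)]
    show "\<mu> m * dst n (i + 1) m * (\<Sum>j = 1..n. dst n (j + 1) m * dst n (j + 1) k)
      = (if m = k then \<mu> m * dst n (i + 1) m else 0)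
      - 4 / (real n + 3) * sn n k * (if even (m + k) then \<mu> m * (sn n m * dst n (i + 1) m) else 0)"
      by (simp only: right_diff_distrib) (cases "m = k"; cases "even (m + k)"; simp only: if_True if_False refl; simp)
  qed
  also have "\<dots> = \<mu> k * dst n (i + 1) k - 4 / (real n + 3) * sn n k *
      (\<Sum>m = 1..n + 2. if even (m + k) then \<mu> m * (sn n m * dst n (i + 1) m) else 0)"
    unfolding sum_subtractf sum_distrib_left[symmetric] by (subst sum.delta) (use assms(2) in auto)
  finally show ?thesis .
qed

text \<open>The order in which \<open>R\<close> times the permutation matrix lists the columns of the sine transform:
  first the odd indices without 1, then the even indices without the largest one.\<close>

definition parity_index :: "nat \<Rightarrow> nat \<Rightarrow> nat" where
  "parity_index n k = (if k \<le> (n + 1) div 2 then 2 * k + 1 else 2 * (k - (n + 1) div 2))"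

definition parity_dst :: "nat \<Rightarrow> real mat" where
  "parity_dst n = mat1 n n (\<lambda>i k. dst n (i + 1) (parity_index n k))"

section \<open>The Hankel matrix in the basis of parity-sorted sine columns\<close>

context
  fixes n p q :: nat
  assumes n_pos: "n \<ge> 1" and p_def: "p = (n + 1) div 2" and q_def: "q = n div 2"
begin

lemma pq: "p + q = n" using n_pos by (auto simp: p_def q_def)

lemma parity_index_simps: "k \<in> {1..p} \<Longrightarrow> parity_index n k = 2 * k + 1" "k \<in> {1..q} \<Longrightarrow> parity_index n (p + k) = 2 * k"
  by (auto simp: parity_index_def p_def)

lemma sum_pq: "(\<Sum>k = 1..n. f k) = (\<Sum>k = 1..p. f k) + (\<Sum>k = 1..q. f (p + k))"
  for f :: "nat \<Rightarrow> 'b :: comm_monoid_add"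
  using sum_atLeast1_add[of f p q] by (simp only: pq)

text \<open>The inner rows are orthonormal over all \<open>n + 2\<close> columns; eliminating two
  columns by the linear relations turns this into a product of two square matrices.\<close>

lemma parity_dst_right_inverse: "\<exists>X \<in> carrier_mat n n. parity_dst n * X = 1\<^sub>m n"
proof
  \<comment> \<open>The entries are the coefficients produced by \<open>sum_eliminate\<close> when
    \<open>u\<close> is row \<open>j + 1\<close>, with omitted index \<open>0\<close> in the odd and
    \<open>q + 1\<close> in the even class.\<close>
  define X where "X = mat1 n n (\<lambda>k j. if k \<le> p
    then dst n (j + 1) (2 * k + 1) - sn n (2 * k + 1) / sn n (2 * 0 + 1) * dst n (j + 1) (2 * 0 + 1)
    else dst n (j + 1) (2 * (k - p)) - sn n (2 * (k - p)) / sn n (2 * (q + 1)) * dst n (j + 1) (2 * (q + 1)))"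
  show "X \<in> carrier_mat n n" by (simp add: X_def)
  have sn: "sn n (2 * 0 + 1) \<noteq> 0" "sn n (2 * (q + 1)) \<noteq> 0"
    using sn_pos[of "2 * 0 + 1" n] sn_pos[of "2 * (q + 1)" n] by (auto simp: q_def)
  show "parity_dst n * X = 1\<^sub>m n"
    unfolding parity_dst_def X_def mat1_mult one_mat1
  proof (rule mat1_eqI)
    fix i j assume ij: "i \<in> {1..n}" "j \<in> {1..n}"
    note zero = sum_sn_dst[OF ij(1), folded p_def q_def]
    show "(\<Sum>k = 1..n. dst n (i + 1) (parity_index n k) * (if k \<le> p
      then dst n (j + 1) (2 * k + 1) - sn n (2 * k + 1) / sn n (2 * 0 + 1) * dst n (j + 1) (2 * 0 + 1)
      else dst n (j + 1) (2 * (k - p)) - sn n (2 * (k - p)) / sn n (2 * (q + 1)) * dst n (j + 1) (2 * (q + 1))))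
      = (if i = j then 1 else 0)" (is "?S = _")
    proof -
      have "?S = (\<Sum>k = 1..p. dst n (i + 1) (2 * k + 1) * (dst n (j + 1) (2 * k + 1)
          - sn n (2 * k + 1) / sn n (2 * 0 + 1) * dst n (j + 1) (2 * 0 + 1)))
        + (\<Sum>k = 1..q. dst n (i + 1) (2 * k) * (dst n (j + 1) (2 * k)
          - sn n (2 * k) / sn n (2 * (q + 1)) * dst n (j + 1) (2 * (q + 1))))"
        unfolding sum_pq
        by (intro arg_cong2[of _ _ _ _ "(+)"] sum.cong refl) (auto simp: parity_index_simps[unfolded atLeastAtMost_iff])
      also have "\<dots> = (\<Sum>m = 1..n + 2. dst n (i + 1) m * dst n (j + 1) m)"
        unfolding sum_parity_split p_def[symmetric] q_def[symmetric]
        by (intro arg_cong2[of _ _ _ _ "(+)"] sum_eliminate[where s = "\<lambda>k. sn n (2 * k + 1)"]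
          sum_eliminate[where s = "\<lambda>k. sn n (2 * k)"] zero sn) auto
      also have "\<dots> = (if i = j then 1 else 0)"
        using ij by (subst sum_dst_mult) auto
      finally show ?thesis .
    qed
  qed
qed

context
  fixes a b c d :: real and \<mu> \<mu>o \<mu>e :: "nat \<Rightarrow> real" and \<kappa> :: real
  assumes \<mu>: "\<mu> = lam n a b c d" and \<mu>o: "\<mu>o = (\<lambda>k. \<mu> (2 * k + 1))" and \<mu>e: "\<mu>e = (\<lambda>k. \<mu> (2 * k))"
    and \<kappa>: "\<kappa> = 4 / (real n + 3)"
begin

text \<open>\<open>Mo\<close> and \<open>Me\<close> are the two instances of \<open>sec_mat\<close>,
  written out ahead of the interpretations of \<open>secular\<close>.\<close>

definition "Mo = mat1 p p (\<lambda>k l. (if k = l then \<mu>o k else 0) - \<kappa> * ((\<mu>o k - \<mu>o 0) * sn n (2 * k + 1)) * sn n (2 * l + 1))"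
definition "Me = mat1 q q (\<lambda>k l. (if k = l then \<mu>e k else 0) - \<kappa> * ((\<mu>e k - \<mu>e (q + 1)) * sn n (2 * k)) * sn n (2 * l))"

text \<open>The image of a column involves only columns of its own parity, by
  \<open>hankel_mult_dst\<close>; \<open>sum_rank_one_column\<close> then removes the column that is
  not part of the basis.\<close>

lemma hankel_mult_parity_dst: "hankel_mat n a b c d * parity_dst n = parity_dst n * block_diag Mo Me"
proof -
  define H where "H i j = hankel_mat n a b c d $$ (i - 1, j - 1)" for i j
  define v where "v i m = dst n (i + 1) m" for i m
  have hankel: "hankel_mat n a b c d = mat1 n n H"
    by (rule eq_matI) (auto simp: mat1_def H_def hankel_mat_def)
  let ?fo = "\<lambda>k l. (if k = l then \<mu>o k else 0) - \<kappa> * ((\<mu>o k - \<mu>o 0) * sn n (2 * k + 1)) * sn n (2 * l + 1)"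
  let ?fe = "\<lambda>k l. (if k = l then \<mu>e k else 0) - \<kappa> * ((\<mu>e k - \<mu>e (q + 1)) * sn n (2 * k)) * sn n (2 * l)"
  let ?f = "\<lambda>k l. if k \<le> p then if l \<le> p then ?fo k l else 0 else if l \<le> p then 0 else ?fe (k - p) (l - p)"
  have block: "block_diag Mo Me = mat1 n n ?f"
    unfolding Mo_def Me_def block_diag_mat1 by (simp only: pq)
  have PD: "parity_dst n = mat1 n n (\<lambda>i k. v i (parity_index n k))"
    by (simp add: parity_dst_def v_def)
  have "(\<Sum>j = 1..n. H i j * v j (parity_index n l)) = (\<Sum>k = 1..n. v i (parity_index n k) * ?f k l)"
    if i: "i \<in> {1..n}" and l: "l \<in> {1..n}" for i l
  proof -
    note zero = sum_sn_dst[OF i, folded p_def q_def v_def]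
    have R: "(\<Sum>k = 1..n. v i (parity_index n k) * ?f k l)
      = (if l \<le> p then \<Sum>k = 1..p. v i (2 * k + 1) * ?fo k l else \<Sum>k = 1..q. v i (2 * k) * ?fe k (l - p))"
    proof -
      have "(\<Sum>k = 1..n. v i (parity_index n k) * ?f k l)
        = (\<Sum>k = 1..p. v i (2 * k + 1) * (if l \<le> p then ?fo k l else 0))
          + (\<Sum>k = 1..q. v i (2 * k) * (if l \<le> p then 0 else ?fe k (l - p)))"
        unfolding sum_pq
        by (intro arg_cong2[of _ _ _ _ "(+)"] sum.cong refl) (auto simp: parity_index_simps[unfolded atLeastAtMost_iff])
      then show ?thesis by (cases "l \<le> p") simp_all
    qed
    show ?thesis
    proof (cases "l \<le> p")
      case True
      then have l': "l \<in> {1..p}" "parity_index n l = 2 * l + 1" using l parity_index_simps by auto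
      then have "parity_index n l \<in> {1..n + 2}" by (auto simp: p_def)
      from hankel_mult_dst[OF i this, of a b c d]
      have "(\<Sum>j = 1..n. H i j * v j (parity_index n l)) = \<mu>o l * v i (2 * l + 1)
        - \<kappa> * sn n (2 * l + 1) * (\<Sum>k \<in> insert 0 {1..p}. \<mu>o k * (sn n (2 * k + 1) * v i (2 * k + 1)))"
        unfolding H_def v_def sum_parity_split l'(2) p_def[symmetric] q_def[symmetric]
        by (simp add: \<mu> \<mu>o \<kappa> del: sum.insert)
      also have "\<dots> = (\<Sum>k = 1..p. v i (2 * k + 1) * ?fo k l)"
        using l'(1) zero(1) by (intro sum_rank_one_column) auto
      finally show ?thesis unfolding R using True by simp
    next
      case False
      define k where "k = l - p"
      have k: "k \<in> {1..q}" "l = p + k" using l False pq by (auto simp: k_def)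
      then have l': "parity_index n l = 2 * k" using parity_index_simps by auto
      then have "parity_index n l \<in> {1..n + 2}" using k by (auto simp: q_def)
      from hankel_mult_dst[OF i this, of a b c d]
      have "(\<Sum>j = 1..n. H i j * v j (parity_index n l)) = \<mu>e k * v i (2 * k)
        - \<kappa> * sn n (2 * k) * (\<Sum>k \<in> insert (q + 1) {1..q}. \<mu>e k * (sn n (2 * k) * v i (2 * k)))"
        unfolding H_def v_def sum_parity_split l' p_def[symmetric] q_def[symmetric]
        by (simp add: \<mu> \<mu>e \<kappa> del: sum.insert)
      also have "\<dots> = (\<Sum>j = 1..q. v i (2 * j) * ?fe j k)"
        using k(1) zero(2) by (intro sum_rank_one_column) auto
      finally show ?thesis unfolding R using False by (simp add: k_def)
    qed
  qed
  then show ?thesis unfolding hankel block PD mat1_mult by (rule mat1_eqI)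
qed

context
  assumes inj_odd: "inj_on \<mu> {k \<in> {1..2 * p + 1}. odd k}"
    and inj_even: "inj_on \<mu> {k \<in> {2..2 * (q + 1)}. even k}"
begin

text \<open>The omitted index \<open>0\<close> stands for \<open>\<mu> 1\<close>.\<close>

interpretation F: secular p 0 \<kappa> \<mu>o "\<lambda>k. sn n (2 * k + 1)"
proof
  show "inj_on \<mu>o (insert 0 {1..p})"
    unfolding \<mu>o by (rule inj_onI) (auto dest!: inj_onD[OF inj_odd])
  show "sn n (2 * k + 1) > 0" if "k \<in> insert 0 {1..p}" for k
    using that by (intro sn_pos) (auto simp: p_def)
qed (use sum_sn_squares(1)[of n] in \<open>simp_all add: \<kappa> p_def\<close>)

interpretation G: secular q "q + 1" \<kappa> \<mu>e "\<lambda>k. sn n (2 * k)"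
proof
  show "inj_on \<mu>e (insert (q + 1) {1..q})"
    unfolding \<mu>e by (rule inj_onI) (auto dest!: inj_onD[OF inj_even])
  show "sn n (2 * k) > 0" if "k \<in> insert (q + 1) {1..q}" for k
    using that by (intro sn_pos) (auto simp: q_def)
qed (use sum_sn_squares(2)[of n] in \<open>simp_all add: \<kappa> q_def\<close>)

text \<open>Both parities of \<open>n\<close> are covered at once: all that matters about
  \<open>R\<close> and \<open>Q\<close> is that their product is \<open>parity_dst n\<close> and
  that \<open>Q\<close> is orthogonal.\<close>

lemma hankel_diagonalization:
  assumes zeros: "lists_zeros (F_poly n a b c d p) p \<phi>" "lists_zeros (G_poly n a b c d (2 * (q + 1)) q) q \<psi>"
    and R: "R \<in> carrier_mat n n" and Q: "Q \<in> carrier_mat n n" "transpose_mat Q * Q = 1\<^sub>m n"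
    and RQ: "R * Q = parity_dst n"
  defines "FM \<equiv> F_mat n a b c d p \<phi>" and "GM \<equiv> G_mat n a b c d (2 * (q + 1)) q \<psi>"
  shows "\<forall>k \<in> {1..p}. \<forall>l \<in> {1..p}. complex_of_real (lam n a b c d (2 * k + 1)) - \<phi> l \<noteq> 0"
    and "\<forall>k \<in> {1..q}. \<forall>l \<in> {1..q}. complex_of_real (lam n a b c d (2 * k)) - \<psi> l \<noteq> 0"
    and "invertible_mat FM" "invertible_mat GM" "invertible_mat R"
    and "cmat (hankel_mat n a b c d) = cmat R * cmat Q * block_diag FM GM * diag_zeros p q \<phi> \<psi>
      * block_diag (minv FM) (minv GM) * cmat (transpose_mat Q) * cmat (minv R)"
proof -
  have "F_poly n a b c d p = F.sec_poly"
    unfolding F_poly_def F.sec_poly_def by (simp add: \<mu> \<mu>o \<kappa>)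
  then have zF: "lists_zeros F.sec_poly p \<phi>" using zeros by simp
  have "G_poly n a b c d (2 * (q + 1)) q = G.sec_poly"
    unfolding G_poly_def G.sec_poly_def by (simp add: \<mu> \<mu>e \<kappa>)
  then have zG: "lists_zeros G.sec_poly q \<psi>" using zeros by simp
  have FM: "FM = F.eigen_mat \<phi>" unfolding FM_def F_mat_def F.eigen_mat_def by (simp add: \<mu> \<mu>o)
  have GM: "GM = G.eigen_mat \<psi>" unfolding GM_def G_mat_def G.eigen_mat_def by (simp add: \<mu> \<mu>e)
  have Mo: "Mo = F.sec_mat" and Me: "Me = G.sec_mat"
    unfolding Mo_def Me_def F.sec_mat_def G.sec_mat_def by simp_all
  show "\<forall>k \<in> {1..p}. \<forall>l \<in> {1..p}. complex_of_real (lam n a b c d (2 * k + 1)) - \<phi> l \<noteq> 0"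
    using F.zeros_neq[OF zF, unfolded F.I_def] unfolding \<mu>o \<mu> by blast
  show "\<forall>k \<in> {1..q}. \<forall>l \<in> {1..q}. complex_of_real (lam n a b c d (2 * k)) - \<psi> l \<noteq> 0"
    using G.zeros_neq[OF zG, unfolded G.I_def] unfolding \<mu>e \<mu> by blast
  show FMi: "invertible_mat FM" unfolding FM by (rule F.invertible_eigen_mat[OF zF])
  show GMi: "invertible_mat GM" unfolding GM by (rule G.invertible_eigen_mat[OF zG])
  obtain X where X: "X \<in> carrier_mat n n" "parity_dst n * X = 1\<^sub>m n" using parity_dst_right_inverse by blast
  \<comment> \<open>A right inverse of the product \<open>R * Q\<close> yields one of
    \<open>R\<close>.\<close>
  have "R * (Q * X) = 1\<^sub>m n"
    using X(2) unfolding RQ[symmetric] by (simp add: assoc_mult_mat[OF R Q(1) X(1)])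
  then show Ri: "invertible_mat R" by (rule invertible_matI_right[OF R mult_carrier_mat[OF Q(1) X(1)]])
  have c: "FM \<in> carrier_mat p p" "GM \<in> carrier_mat q q" "Mo \<in> carrier_mat p p" "Me \<in> carrier_mat q q"
    "parity_dst n \<in> carrier_mat n n" "hankel_mat n a b c d \<in> carrier_mat n n"
    by (simp_all add: FM_def GM_def F_mat_def G_mat_def Mo_def Me_def parity_dst_def hankel_mat_def)
  have cc: "cmat Mo \<in> carrier_mat p p" "cmat Me \<in> carrier_mat q q" using c by auto
  note block_carrier = block_diag_carrier[of _ p _ q, unfolded pq]
  note FMm = minv_inverse[OF c(1) FMi] and GMm = minv_inverse[OF c(2) GMi] and Rm = minv_inverse[OF R Ri]
  show "cmat (hankel_mat n a b c d) = cmat R * cmat Q * block_diag FM GM * diag_zeros p q \<phi> \<psi>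
      * block_diag (minv FM) (minv GM) * cmat (transpose_mat Q) * cmat (minv R)"
  proof (rule diagonalization_transfer[where M = "block_diag (cmat Mo) (cmat Me)"])
    have "cmat (hankel_mat n a b c d) * cmat (parity_dst n) = cmat (parity_dst n) * cmat (block_diag Mo Me)"
      using c block_carrier[OF c(3,4)]
      by (simp add: hankel_mult_parity_dst flip: of_real_hom.mat_hom_mult[of _ n n _ n])
    then show "cmat (hankel_mat n a b c d) * (cmat R * cmat Q)
        = cmat R * cmat Q * block_diag (cmat Mo) (cmat Me)"
      unfolding of_real_hom.mat_hom_mult[OF R Q(1), symmetric] RQ cmat_block_diag[OF c(3,4)] .
    show "block_diag (cmat Mo) (cmat Me) * block_diag FM GM = block_diag FM GM * diag_zeros p q \<phi> \<psi>"
      unfolding diag_zeros_block_diag block_diag_mult[OF cc c(1,2)]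
        block_diag_mult[OF c(1,2) mat_diag_dim mat_diag_dim]
      unfolding FM GM Mo Me by (simp only: F.sec_mat_eigen_mat[OF zF] G.sec_mat_eigen_mat[OF zG])
    show "block_diag FM GM * block_diag (minv FM) (minv GM) = 1\<^sub>m n"
      unfolding block_diag_mult[OF c(1,2) FMm(2) GMm(2)] FMm(1) GMm(1)
      by (simp add: block_diag_def pq)
    have "transpose_mat Q \<in> carrier_mat n n" using Q by simp
    from of_real_hom.mat_hom_mult[OF this Q(1)] show "cmat (transpose_mat Q) * cmat Q = 1\<^sub>m n"
      unfolding Q(2) of_real_hom.mat_hom_one ..
    from of_real_hom.mat_hom_mult[OF R Rm(2)] show "cmat R * cmat (minv R) = 1\<^sub>m n"
      unfolding Rm(1) of_real_hom.mat_hom_one ..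
  qed (use R Q c Rm block_carrier[OF cc] block_carrier[OF c(1,2)] block_carrier[OF FMm(2) GMm(2)] in \<open>auto simp: diag_zeros_def pq\<close>)
qed

end

end

end

section \<open>The permutation matrices for even and odd order\<close>

text \<open>Column \<open>l\<close> of \<open>R_even\<close> is column \<open>l + 1\<close> of the
  sine transform, and the transposed permutation selects column \<open>\<sigma> j\<close>. So the
  columns appear as 3, 5, ..., n + 1, followed by 2, 4, ..., n.\<close>

lemma even_permutation:
  assumes "even n"
  shows "R_even n * transpose_mat (P_even n) = parity_dst n"
    and "P_even n * transpose_mat (P_even n) = 1\<^sub>m n"
proof -
  obtain h where h: "n = 2 * h" using assms by (elim evenE)
  define \<sigma> where "\<sigma> j = (if j \<le> h then 2 * j else 2 * j - n - 1)" for j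
  define Q :: "real mat" where "Q = mat1 n n (\<lambda>k l. if k = \<sigma> l then 1 else 0)"
  have \<sigma>: "\<sigma> j \<in> {1..n}" if "j \<in> {1..n}" for j
    using that by (auto simp: \<sigma>_def h)
  have inj: "inj_on \<sigma> {1..n}"
  proof (rule inj_onI)
    fix i j assume "i \<in> {1..n}" "j \<in> {1..n}" "\<sigma> i = \<sigma> j"
    then show "i = j" unfolding \<sigma>_def h by (simp split: if_splits; presburger)
  qed
  have Q: "transpose_mat (P_even n) = Q"
    unfolding P_even_def Q_def transpose_mat1
  proof (intro mat1_eqI if_cong refl)
    fix k l assume "k \<in> {1..n}" "l \<in> {1..n}"
    then show "(k = 2 * l \<or> k + n + 1 = 2 * l) = (k = \<sigma> l)" unfolding \<sigma>_def h by auto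
  qed
  have "R_even n * Q = mat1 n n (\<lambda>i j. sqrt (2 / (real n + 3)) * sin ((real i + 1) * (real (\<sigma> j) + 1) * pi / (real n + 3)))"
    unfolding Q_def R_even_def by (rule mat1_mult_selection) (rule \<sigma>)
  also have "\<dots> = parity_dst n"
    unfolding parity_dst_def dst_def
  proof (rule mat1_eqI)
    fix i j assume "j \<in> {1..n}"
    then have "parity_index n j = \<sigma> j + 1" by (auto simp: parity_index_def \<sigma>_def h)
    then show "sqrt (2 / (real n + 3)) * sin ((real i + 1) * (real (\<sigma> j) + 1) * pi / (real n + 3))
      = sqrt (2 / (real n + 3)) * sin (real (i + 1) * real (parity_index n j) * pi / (real n + 3))"
      by (simp add: add.commute)
  qed
  finally show "R_even n * transpose_mat (P_even n) = parity_dst n" unfolding Q .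
  have "P_even n = transpose_mat Q" by (simp flip: Q)
  then show "P_even n * transpose_mat (P_even n) = 1\<^sub>m n"
    unfolding Q using transpose_selection_mult[OF \<sigma> inj] by (simp add: Q_def)
qed

text \<open>The last column of \<open>R_odd\<close> jumps to column \<open>n + 2\<close> of the sine
  transform, leaving out \<open>n + 1\<close>, the largest even index. The extra clause of
  \<open>P_odd\<close> moves it to the end of the odd group.\<close>

lemma odd_permutation:
  assumes "odd n"
  shows "R_odd n * P_odd n = parity_dst n"
    and "transpose_mat (P_odd n) * P_odd n = 1\<^sub>m n"
proof -
  obtain h where h: "n = 2 * h + 1" using assms by (elim oddE)
  define \<sigma> where "\<sigma> j = (if j \<le> h then 2 * j else if j = h + 1 then n else 2 * j - n - 2)" for j
  define Q :: "real mat" where "Q = mat1 n n (\<lambda>k l. if k = \<sigma> l then 1 else 0)"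
  have \<sigma>: "\<sigma> j \<in> {1..n}" if "j \<in> {1..n}" for j
    using that by (auto simp: \<sigma>_def h)
  have inj: "inj_on \<sigma> {1..n}"
  proof (rule inj_onI)
    fix i j assume "i \<in> {1..n}" "j \<in> {1..n}" "\<sigma> i = \<sigma> j"
    then show "i = j" unfolding \<sigma>_def h atLeastAtMost_iff
      by (cases "i \<le> h"; cases "j \<le> h"; cases "i = h + 1"; cases "j = h + 1"; simp only: if_True if_False; presburger)
  qed
  have Q: "P_odd n = Q"
    unfolding P_odd_def Q_def
  proof (intro mat1_eqI if_cong refl)
    fix k l assume "k \<in> {1..n}" "l \<in> {1..n}"
    then show "(k = 2 * l \<or> k + n + 2 = 2 * l \<or> (k = n \<and> l = (n + 1) div 2)) = (k = \<sigma> l)"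
      unfolding \<sigma>_def h by auto
  qed
  have "R_odd n * Q = mat1 n n (\<lambda>i j. if \<sigma> j < n
      then sqrt (2 / (real n + 3)) * sin ((real i + 1) * (real (\<sigma> j) + 1) * pi / (real n + 3))
      else sqrt (2 / (real n + 3)) * sin ((real i + 1) * (real n + 2) * pi / (real n + 3)))"
    unfolding Q_def R_odd_def by (rule mat1_mult_selection) (rule \<sigma>)
  also have "\<dots> = parity_dst n"
    unfolding parity_dst_def dst_def
  proof (rule mat1_eqI)
    fix i j assume "j \<in> {1..n}"
    then have "parity_index n j = (if \<sigma> j < n then \<sigma> j + 1 else n + 2)"
      by (auto simp: parity_index_def \<sigma>_def h)
    then show "(if \<sigma> j < n
        then sqrt (2 / (real n + 3)) * sin ((real i + 1) * (real (\<sigma> j) + 1) * pi / (real n + 3))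
        else sqrt (2 / (real n + 3)) * sin ((real i + 1) * (real n + 2) * pi / (real n + 3)))
      = sqrt (2 / (real n + 3)) * sin (real (i + 1) * real (parity_index n j) * pi / (real n + 3))"
      by (simp add: add.commute)
  qed
  finally show "R_odd n * P_odd n = parity_dst n" unfolding Q .
  show "transpose_mat (P_odd n) * P_odd n = 1\<^sub>m n"
    unfolding Q unfolding Q_def by (rule transpose_selection_mult[OF \<sigma> inj])
qed

theorem theorem4:
  fixes n :: nat and a b c d :: real and \<phi> \<psi> :: "nat \<Rightarrow> complex"
  assumes "n \<ge> 1"
  shows
    "(even n \<longrightarrow>
        inj_on (lam n a b c d) {k \<in> {1..n + 1}. odd k} \<longrightarrow>
        inj_on (lam n a b c d) {k \<in> {2..n + 2}. even k} \<longrightarrow>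
        lists_zeros (F_poly n a b c d (n div 2)) (n div 2) \<phi> \<longrightarrow>
        lists_zeros (G_poly n a b c d (n + 2) (n div 2)) (n div 2) \<psi> \<longrightarrow>
        (\<forall>k \<in> {1..n div 2}. \<forall>l \<in> {1..n div 2}.
           complex_of_real (lam n a b c d (2 * k + 1)) - \<phi> l \<noteq> 0) \<and>
        (\<forall>k \<in> {1..n div 2}. \<forall>l \<in> {1..n div 2}.
           complex_of_real (lam n a b c d (2 * k)) - \<psi> l \<noteq> 0) \<and>
        invertible_mat (F_mat n a b c d (n div 2) \<phi>) \<and>
        invertible_mat (G_mat n a b c d (n + 2) (n div 2) \<psi>) \<and>
        invertible_mat (R_even n) \<and>
        cmat (hankel_mat n a b c d) =
          cmat (R_even n) * cmat (transpose_mat (P_even n))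
          * block_diag (F_mat n a b c d (n div 2) \<phi>) (G_mat n a b c d (n + 2) (n div 2) \<psi>)
          * diag_zeros (n div 2) (n div 2) \<phi> \<psi>
          * block_diag (minv (F_mat n a b c d (n div 2) \<phi>))
                       (minv (G_mat n a b c d (n + 2) (n div 2) \<psi>))
          * cmat (P_even n) * cmat (minv (R_even n)))
     \<and>
     (odd n \<longrightarrow>
        inj_on (lam n a b c d) {k \<in> {1..n + 2}. odd k} \<longrightarrow>
        inj_on (lam n a b c d) {k \<in> {2..n + 1}. even k} \<longrightarrow>
        lists_zeros (F_poly n a b c d ((n + 1) div 2)) ((n + 1) div 2) \<phi> \<longrightarrow>
        lists_zeros (G_poly n a b c d (n + 1) ((n - 1) div 2)) ((n - 1) div 2) \<psi> \<longrightarrow>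
        (\<forall>k \<in> {1..(n + 1) div 2}. \<forall>l \<in> {1..(n + 1) div 2}.
           complex_of_real (lam n a b c d (2 * k + 1)) - \<phi> l \<noteq> 0) \<and>
        (\<forall>k \<in> {1..(n - 1) div 2}. \<forall>l \<in> {1..(n - 1) div 2}.
           complex_of_real (lam n a b c d (2 * k)) - \<psi> l \<noteq> 0) \<and>
        invertible_mat (F_mat n a b c d ((n + 1) div 2) \<phi>) \<and>
        invertible_mat (G_mat n a b c d (n + 1) ((n - 1) div 2) \<psi>) \<and>
        invertible_mat (R_odd n) \<and>
        cmat (hankel_mat n a b c d) =
          cmat (R_odd n) * cmat (P_odd n)
          * block_diag (F_mat n a b c d ((n + 1) div 2) \<phi>)
                       (G_mat n a b c d (n + 1) ((n - 1) div 2) \<psi>)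
          * diag_zeros ((n + 1) div 2) ((n - 1) div 2) \<phi> \<psi>
          * block_diag (minv (F_mat n a b c d ((n + 1) div 2) \<phi>))
                       (minv (G_mat n a b c d (n + 1) ((n - 1) div 2) \<psi>))
          * cmat (transpose_mat (P_odd n)) * cmat (minv (R_odd n)))"
proof (rule conjI; intro impI)
  assume n: "even n"
    and inj: "inj_on (lam n a b c d) {k \<in> {1..n + 1}. odd k}" "inj_on (lam n a b c d) {k \<in> {2..n + 2}. even k}"
    and zeros: "lists_zeros (F_poly n a b c d (n div 2)) (n div 2) \<phi>"
      "lists_zeros (G_poly n a b c d (n + 2) (n div 2)) (n div 2) \<psi>"
  have p: "n div 2 = (n + 1) div 2" and indices: "2 * (n div 2) + 1 = n + 1" "2 * (n div 2 + 1) = n + 2"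
    using n by auto
  have c: "R_even n \<in> carrier_mat n n" "transpose_mat (P_even n) \<in> carrier_mat n n"
    by (simp_all add: R_even_def P_even_def)
  \<comment> \<open>For even \<open>n\<close> the transpose of \<open>P_even\<close> takes the place
    of \<open>Q\<close>.\<close>
  have P: "transpose_mat (transpose_mat (P_even n)) * transpose_mat (P_even n) = 1\<^sub>m n"
    using even_permutation(2)[OF n] by simp
  note D = hankel_diagonalization[OF assms p refl refl refl refl refl, unfolded indices,
      OF inj zeros c P even_permutation(1)[OF n], unfolded transpose_transpose]
  show "(\<forall>k \<in> {1..n div 2}. \<forall>l \<in> {1..n div 2}. complex_of_real (lam n a b c d (2 * k + 1)) - \<phi> l \<noteq> 0) \<and>
    (\<forall>k \<in> {1..n div 2}. \<forall>l \<in> {1..n div 2}. complex_of_real (lam n a b c d (2 * k)) - \<psi> l \<noteq> 0) \<and>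
    invertible_mat (F_mat n a b c d (n div 2) \<phi>) \<and>
    invertible_mat (G_mat n a b c d (n + 2) (n div 2) \<psi>) \<and>
    invertible_mat (R_even n) \<and>
    cmat (hankel_mat n a b c d) =
      cmat (R_even n) * cmat (transpose_mat (P_even n))
      * block_diag (F_mat n a b c d (n div 2) \<phi>) (G_mat n a b c d (n + 2) (n div 2) \<psi>)
      * diag_zeros (n div 2) (n div 2) \<phi> \<psi>
      * block_diag (minv (F_mat n a b c d (n div 2) \<phi>)) (minv (G_mat n a b c d (n + 2) (n div 2) \<psi>))
      * cmat (P_even n) * cmat (minv (R_even n))"
    by (intro conjI D)
next
  assume n: "odd n"
    and inj: "inj_on (lam n a b c d) {k \<in> {1..n + 2}. odd k}" "inj_on (lam n a b c d) {k \<in> {2..n + 1}. even k}"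
    and zeros: "lists_zeros (F_poly n a b c d ((n + 1) div 2)) ((n + 1) div 2) \<phi>"
      "lists_zeros (G_poly n a b c d (n + 1) ((n - 1) div 2)) ((n - 1) div 2) \<psi>"
  have q: "(n - 1) div 2 = n div 2"
    and indices: "2 * ((n + 1) div 2) + 1 = n + 2" "2 * ((n - 1) div 2 + 1) = n + 1"
    using n by (auto elim!: oddE)
  have c: "R_odd n \<in> carrier_mat n n" "P_odd n \<in> carrier_mat n n"
    by (simp_all add: R_odd_def P_odd_def)
  note D = hankel_diagonalization[OF assms refl q refl refl refl refl, unfolded indices,
      OF inj zeros c odd_permutation(2,1)[OF n]]
  show "(\<forall>k \<in> {1..(n + 1) div 2}. \<forall>l \<in> {1..(n + 1) div 2}. complex_of_real (lam n a b c d (2 * k + 1)) - \<phi> l \<noteq> 0) \<and>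
    (\<forall>k \<in> {1..(n - 1) div 2}. \<forall>l \<in> {1..(n - 1) div 2}. complex_of_real (lam n a b c d (2 * k)) - \<psi> l \<noteq> 0) \<and>
    invertible_mat (F_mat n a b c d ((n + 1) div 2) \<phi>) \<and>
    invertible_mat (G_mat n a b c d (n + 1) ((n - 1) div 2) \<psi>) \<and>
    invertible_mat (R_odd n) \<and>
    cmat (hankel_mat n a b c d) =
      cmat (R_odd n) * cmat (P_odd n)
      * block_diag (F_mat n a b c d ((n + 1) div 2) \<phi>) (G_mat n a b c d (n + 1) ((n - 1) div 2) \<psi>)
      * diag_zeros ((n + 1) div 2) ((n - 1) div 2) \<phi> \<psi>
      * block_diag (minv (F_mat n a b c d ((n + 1) div 2) \<phi>)) (minv (G_mat n a b c d (n + 1) ((n - 1) div 2) \<psi>))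
      * cmat (transpose_mat (P_odd n)) * cmat (minv (R_odd n))"
    by (intro conjI D)
qed

end
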